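(* Let $\{X, X_{n}; n \geq 1\}$ be a sequence of i.i.d. non-degenerate real-valued random variables with $\mathbb{E}X^{2} < \infty$, and let $S_n=\sum_{i=1}^n X_i$. Write $\mu = \mathbb{E}X$ and $\sigma^{2} = \mathbb{E}(X - \mu)^{2} \in (0, \infty)$. Let $\rho\ge 0$ and $g \in \mathcal{V}_{\rho}$. Then for all $x>0$: \[ \limsup_{n \rightarrow \infty} \frac{\log \mathbb{P}\left(S_{n} - n \mu > x \sqrt{n g(\log n)} \right)}{g(\log n)} = - \left(\frac{x^{2}}{2\sigma^{2}} \wedge \frac{\overline{\lambda}_{1}}{2^{\rho}} \right),\quad \liminf_{n \rightarrow \infty} \frac{\log \mathbb{P}\left(S_{n} - n \mu > x \sqrt{n g(\log n)} \right)}{g(\log n)} = - \left(\frac{x^{2}}{2\sigma^{2}} \wedge \frac{\underline{\lambda}_{1}}{2^{\rho}} \right), \] \[ \limsup_{n \rightarrow \infty} \frac{\log \mathbb{P}\left(S_{n} - n \mu < -x \sqrt{n g(\log n)} \right)}{g(\log n)} = - \left(\frac{x^{2}}{2\sigma^{2}} \wedge \frac{\overline{\lambda}_{2}}{2^{\rho}} \right),\quad \liminf_{n \rightarrow \infty} \frac{\log \mathbb{P}\left(S_{n} - n \mu < - x \sqrt{n g(\log n)} \right)}{g(\log n)} = - \left(\frac{x^{2}}{2\sigma^{2}} \wedge \frac{\underline{\lambda}_{2}}{2^{\rho}} \right), \] \[ \limsup_{n \rightarrow \infty} \frac{\log \mathbb{P}\left(\left|S_{n} - n \mu \right| > x \sqrt{n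 g(\log n)} \right)}{g(\log n)} = - \left(\frac{x^{2}}{2\sigma^{2}} \wedge \frac{\overline{\lambda}}{2^{\rho}} \right),\quad \liminf_{n \rightarrow \infty} \frac{\log \mathbb{P}\left(\left|S_{n} - n \mu \right| > x \sqrt{n g(\log n)} \right)}{g(\log n)} = - \left(\frac{x^{2}}{2\sigma^{2}} \wedge \frac{\underline{\lambda}}{2^{\rho}} \right). \] Hence: $\lim_{n\to\infty} \frac{\log \mathbb{P}(S_{n}- n \mu > x \sqrt{n g(\log n)})}{g(\log n)} = - \left(\frac{x^{2}}{2\sigma^{2}} \wedge \frac{\hat{\lambda}_{1}}{2^{\rho}} \right)$ for all $x > 0$ if and only if $\overline{\lambda}_{1} = \underline{\lambda}_{1} = \hat{\lambda}_{1}$; $\lim_{n\to\infty} \frac{\log \mathbb{P}(S_{n} - n \mu < - x \sqrt{n g(\log n)})}{g(\log n)} = - \left(\frac{x^{2}}{2\sigma^{2}} \wedge \frac{\hat{\lambda}_{2}}{2^{\rho}} \right)$ for all $x > 0$ if and only if $\overline{\lambda}_{2} = \underline{\lambda}_{2} = \hat{\lambda}_{2}$; and $\lim_{n\to\infty} \frac{\log \mathbb{P}(|S_{n} - n \mu| > x \sqrt{n g(\log n)})}{g(\log n)} = - \left(\frac{x^{2}}{2\sigma^{2}} \wedge \frac{\hat{\lambda}}{2^{\rho}} \right)$ for all $x > 0$ if and only if $\overline{\lambda} = \underline{\lambda} = \hat{\lambda}$ (here $\hat\lambda_1,\hat\lambda_2,\hat\lambda\in[0,\infty]$). In particular, $\lim_{n\to\infty}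 \frac{\log \mathbb{P}(S_{n} - n \mu > x \sqrt{n g(\log n)})}{g(\log n)} = - \frac{x^{2}}{2\sigma^{2}}$ for all $x>0$ iff $\overline{\lambda}_{1} = \infty$; $\lim_{n\to\infty} \frac{\log \mathbb{P}(S_{n} - n \mu < - x \sqrt{n g(\log n)})}{g(\log n)} = - \frac{x^{2}}{2\sigma^{2}}$ for all $x>0$ iff $\overline{\lambda}_{2} = \infty$; and $\lim_{n\to\infty} \frac{\log \mathbb{P}(|S_{n} - n \mu| > x \sqrt{n g(\log n)})}{g(\log n)} = - \frac{x^{2}}{2\sigma^{2}}$ for all $x>0$ iff $\overline{\lambda} = \infty$.
   Context: For $\rho\ge 0$, $\mathcal{V}_{\rho}$ denotes the set of all nondecreasing functions $g:[0,\infty)\to[0,\infty)$ that are regularly varying at infinity with index $\rho$ (i.e. $\lim_{t\to\infty} g(xt)/g(t)=x^\rho$ for all $x>0$) and satisfy $\lim_{t\to\infty}g(t)=\infty$. $\log$ is the natural logarithm, with $\log 0=-\infty$; $a\wedge b=\min\{a,b\}$. The parameters (with values in $[0,\infty]$) are $\overline{\lambda}_{1} = - \limsup_{t \to \infty} \frac{\log (t^{2} \mathbb{P}(X > t ))}{g(\log t)}$, $\underline{\lambda}_{1} = - \liminf_{t \to \infty} \frac{\log (t^{2} \mathbb{P}(X > t ))}{g(\log t)}$, $\overline{\lambda}_{2} = - \limsup_{t \to \infty} \frac{\log (t^{2} \mathbb{P}(X < -t ))}{g(\log t)}$, $\underline{\lambda}_{2} = - \liminf_{t \to \infty} \frac{\log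 (t^{2} \mathbb{P}(X < -t ))}{g(\log t)}$, $\overline{\lambda} = - \limsup_{t \to \infty} \frac{\log (t^{2} \mathbb{P}(|X| > t ))}{g(\log t)}$, $\underline{\lambda} = - \liminf_{t \to \infty} \frac{\log (t^{2} \mathbb{P}(|X| > t ))}{g(\log t)}$. *)

theory Defs
  imports "HOL-Probability.Probability"
begin

definition elog :: "real \<Rightarrow> ereal" where
  "elog p = (if p > 0 then ereal (ln p) else -\<infinity>)"

definition regvar_class :: "real \<Rightarrow> (real \<Rightarrow> real) \<Rightarrow> bool" where
  "regvar_class rho g \<longleftrightarrow>
     mono_on {0..} g \<and> (\<forall>t\<ge>0. g t \<ge> 0) \<and>
     (\<forall>x>0. ((\<lambda>t. g (x * t) / g t) \<longlongrightarrow> x powr rho) at_top) \<and>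
     filterlim g at_top at_top"

text \<open>Given a tail function T (e.g. T t = P(X > t)):
  lam_over g T = - limsup_{t->inf} log(t^2 T t) / g(log t),
  lam_under g T = - liminf_{t->inf} log(t^2 T t) / g(log t).\<close>
definition lam_over :: "(real \<Rightarrow> real) \<Rightarrow> (real \<Rightarrow> real) \<Rightarrow> ereal" where
  "lam_over g T = - Limsup at_top (\<lambda>t. elog (t\<^sup>2 * T t) / ereal (g (ln t)))"

definition lam_under :: "(real \<Rightarrow> real) \<Rightarrow> (real \<Rightarrow> real) \<Rightarrow> ereal" where
  "lam_under g T = - Liminf at_top (\<lambda>t. elog (t\<^sup>2 * T t) / ereal (g (ln t)))"

definition ldev :: "(real \<Rightarrow> real) \<Rightarrow> (nat \<Rightarrow> real) \<Rightarrow> nat \<Rightarrow> ereal" where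
  "ldev g P n = elog (P n) / ereal (g (ln (real n)))"

end

(* Write R = x^2/(2 sigma^2), G(n) = g(log n), and centre X.

   Upper bound: truncate at a small multiple of the target t = x sqrt(n G(n)) and apply the Chernoff
   bound with h = t/(n sigma^2).  Splitting the exponential moment at A/h, which is of order
   sqrt(n/G(n)), gives exp(-R G(n) (1 - o(1))) as soon as n P(X > A/h) <= exp(-kappa G(n)).  Only
   this one scale enters, which is what makes the argument work along subsequences of n as well.

   Lower bounds: one big jump gives P(S_n > t) >= (n/2) P(X > 2t); the Gaussian rate R comes from
   cutting {1..n} into about G(n)/L^2 blocks, using the central limit theorem in each block, and
   letting L tend to infinity.

   Since log g(s) = o(s), the scales sqrt(n/G(n)) and sqrt(n G(n)) both have logarithm ~ (log n)/2,
   so g at the logarithm of either is ~ 2^(-rho) G(n).  All constant and linear factors in G(n) are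
   absorbed, and tail estimates at t and estimates at n correspond in both directions. *)

theory Submission
  imports Defs
begin

subsection \<open>Regularly varying scales\<close>

text \<open>The two-sided statement cannot be read off from the one-sided ones: the lower limit of a
  maximum is not determined by the two separate lower limits. For this reason the analytic half runs
  on an abstract tail \<open>T\<close> and abstract probabilities \<open>P\<close>, tied together by
  three hypotheses (upper bound, one jump, Gaussian bound) that survive the addition of two
  instances and a change of the argument of \<open>T\<close> by a constant factor. The second
  property also undoes the centering.

  Two of the four inequalities know the tail only along an unknown set of values t: a bound on the
  upper limit of P from below, when the tail is large only sometimes, and on the lower limit from
  above, when it is small only sometimes. For them an index n must be built from t. Its rounding is
  forced by monotonicity of \<open>T\<close>: upwards for the scale sqrt(n/G(n)) of the upper bound,
  downwards for the jump scale sqrt(n G(n)).\<close>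

lemma ln_le_iff_le_exp: "x > 0 \<Longrightarrow> ln x \<le> y \<longleftrightarrow> x \<le> exp (y :: real)"
  by (metis exp_le_cancel_iff exp_ln)

lemma regvar_class_at_top: "regvar_class rho g \<Longrightarrow> filterlim g at_top at_top"
  by (simp add: regvar_class_def)

lemma regvar_class_mono: "regvar_class rho g \<Longrightarrow> 0 \<le> s \<Longrightarrow> s \<le> t \<Longrightarrow> g s \<le> g t"
  by (auto simp: regvar_class_def mono_on_def)

text \<open>Monotonicity takes the place of locally uniform convergence: \<open>h z\<close> is
  eventually above, or below, \<open>y * f z\<close> for a fixed y slightly smaller, or larger, than
  a. There the defining limit of regular variation applies, and y powr rho is continuous at
  a.\<close>

lemma regvar_class_ratio_tendsto:
  assumes g: "regvar_class rho g" and f: "filterlim f at_top F"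
    and hf: "((\<lambda>z. h z / f z) \<longlongrightarrow> a) F" and a: "a > 0"
  shows "((\<lambda>z. g (h z) / g (f z)) \<longlongrightarrow> a powr rho) F"
proof (rule order_tendstoI)
  have fpos: "\<forall>\<^sub>F z in F. f z > 0" using f by (simp add: filterlim_at_top_dense)
  have gpos: "\<forall>\<^sub>F z in F. g (f z) > 0"
    using filterlim_compose[OF regvar_class_at_top[OF g] f] by (simp add: filterlim_at_top_dense)
  have ratio: "((\<lambda>z. g (y * f z) / g (f z)) \<longlongrightarrow> y powr rho) F" if "y > 0" for y
    using g that by (auto simp: regvar_class_def intro: filterlim_compose[OF _ f])
  have cont: "((\<lambda>y. y powr rho) \<longlongrightarrow> a powr rho) (at a)"
    using a by (intro tendsto_intros) auto
  {
    fix b assume "b < a powr rho"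
    from order_tendstoD(1)[OF cont this] obtain d where d: "d > 0"
      "\<And>y. y \<noteq> a \<Longrightarrow> dist y a < d \<Longrightarrow> y powr rho > b"
      unfolding eventually_at by auto
    \<comment> \<open>The maximum with \<open>a / 2\<close> keeps y positive, as the defining limit
      requires.\<close>
    define y where "y = max (a / 2) (a - d / 2)"
    have y: "y > 0" "y < a" "y powr rho > b"
      using a d by (auto simp: y_def dist_real_def intro!: d(2))
    show "\<forall>\<^sub>F z in F. b < g (h z) / g (f z)"
      using order_tendstoD(1)[OF ratio[OF y(1)] y(3)] order_tendstoD(1)[OF hf y(2)] fpos gpos
    proof eventually_elim
      case (elim z)
      then have "y * f z \<le> h z" by (simp add: field_simps)
      with elim y have "g (y * f z) \<le> g (h z)" by (intro regvar_class_mono[OF g]) auto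
      then have "g (y * f z) / g (f z) \<le> g (h z) / g (f z)"
        using elim by (intro divide_right_mono) auto
      then show ?case using elim by linarith
    qed
  next
    fix b assume "b > a powr rho"
    from order_tendstoD(2)[OF cont this] obtain d where d: "d > 0"
      "\<And>y. y \<noteq> a \<Longrightarrow> dist y a < d \<Longrightarrow> y powr rho < b"
      unfolding eventually_at by auto
    define y where "y = a + d / 2"
    have y: "y > 0" "y > a" "y powr rho < b"
      using a d by (auto simp: y_def dist_real_def intro!: d(2))
    show "\<forall>\<^sub>F z in F. g (h z) / g (f z) < b"
      using order_tendstoD(2)[OF ratio[OF y(1)] y(3)] order_tendstoD(2)[OF hf y(2)]
        order_tendstoD(1)[OF hf a] fpos gpos
    proof eventually_elim
      case (elim z)
      then have "h z \<le> y * f z" "h z \<ge> 0" by (simp_all add: field_simps)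
      with elim y have "g (h z) \<le> g (y * f z)" by (intro regvar_class_mono[OF g]) auto
      then have "g (h z) / g (f z) \<le> g (y * f z) / g (f z)"
        using elim by (intro divide_right_mono) auto
      then show ?case using elim by linarith
    qed
  }
qed

text \<open>Since (t + 1) / t tends to 1, a unit step eventually multiplies g by at most exp
  (\<epsilon> / 2). Iterating the step gives this growth up to a constant, and the other half of
  \<epsilon> absorbs the constant.\<close>

lemma regvar_class_subexponential:
  assumes g: "regvar_class rho g" and e: "\<epsilon> > 0"
  shows "\<forall>\<^sub>F t in at_top. g t \<le> exp (\<epsilon> * t)"
proof -
  have "((\<lambda>t::real. 1 + inverse t) \<longlongrightarrow> 1 + 0) at_top"
    by (intro tendsto_intros tendsto_inverse_0_at_top filterlim_ident)
  moreover have "\<forall>\<^sub>F t::real in at_top. 1 + inverse t = (t + 1) / t"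
    using eventually_gt_at_top[of 0] by eventually_elim (simp add: field_simps)
  ultimately have "((\<lambda>t::real. (t + 1) / t) \<longlongrightarrow> 1) at_top"
    by (simp add: Lim_transform_eventually)
  from regvar_class_ratio_tendsto[OF g filterlim_ident this]
  have "((\<lambda>t. g (t + 1) / g t) \<longlongrightarrow> 1) at_top" by simp
  moreover have "exp (\<epsilon> / 2) > 1" using e by simp
  ultimately have "\<forall>\<^sub>F t in at_top. g (t + 1) / g t < exp (\<epsilon> / 2)"
    by (rule order_tendstoD)
  moreover have "\<forall>\<^sub>F t in at_top. g t > 0"
    using regvar_class_at_top[OF g] by (simp add: filterlim_at_top_dense)
  ultimately have "\<forall>\<^sub>F t in at_top. g (t + 1) \<le> exp (\<epsilon> / 2) * g t \<and> g t > 0"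
    by eventually_elim (simp add: field_simps)
  then obtain s0 where s0: "\<And>t. t \<ge> s0 \<Longrightarrow> g (t + 1) \<le> exp (\<epsilon> / 2) * g t \<and> g t > 0"
    by (auto simp: eventually_at_top_linorder)
  define t0 where "t0 = max 0 s0"
  have step: "g (t0 + real k) \<le> exp (\<epsilon> / 2 * real k) * g t0" for k
  proof (induction k)
    case (Suc k)
    have "g (t0 + real (Suc k)) \<le> exp (\<epsilon> / 2) * g (t0 + real k)"
      using s0[of "t0 + real k"] by (simp add: t0_def add_ac)
    also have "\<dots> \<le> exp (\<epsilon> / 2) * (exp (\<epsilon> / 2 * real k) * g t0)"
      using Suc by simp
    also have "\<dots> = exp (\<epsilon> / 2 * real (Suc k)) * g t0"
      by (simp add: exp_add[symmetric] algebra_simps add_divide_distrib)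
    finally show ?case .
  qed simp
  have g0: "g t0 > 0" using s0[of t0] by (simp add: t0_def)
  show ?thesis
    using eventually_ge_at_top[of "max t0 (2 / \<epsilon> * ln (exp (\<epsilon> / 2 * (1 - t0)) * g t0))"]
  proof eventually_elim
    case (elim t)
    let ?k = "nat \<lceil>t - t0\<rceil>"
    have "t - t0 \<ge> 0" using elim by simp
    then have "real ?k = of_int \<lceil>t - t0\<rceil>" by (simp add: of_nat_nat)
    then have k: "t - t0 \<le> real ?k" "real ?k \<le> t - t0 + 1" by linarith+
    have "ln (exp (\<epsilon> / 2 * (1 - t0)) * g t0) \<le> \<epsilon> / 2 * t"
      using elim e by (simp add: field_simps)
    then have *: "exp (\<epsilon> / 2 * (1 - t0)) * g t0 \<le> exp (\<epsilon> / 2 * t)"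
      using g0 by (subst (asm) ln_le_iff_le_exp) auto
    have "t0 \<ge> 0" by (simp add: t0_def)
    then have "g t \<le> g (t0 + real ?k)"
      using \<open>t - t0 \<ge> 0\<close> k by (intro regvar_class_mono[OF g]) linarith+
    also have "\<dots> \<le> exp (\<epsilon> / 2 * real ?k) * g t0" by (rule step)
    also have "\<dots> \<le> exp (\<epsilon> / 2 * (t - t0 + 1)) * g t0"
      using k e g0 by (intro mult_right_mono) auto
    also have "\<dots> = exp (\<epsilon> / 2 * t) * (exp (\<epsilon> / 2 * (1 - t0)) * g t0)"
      by (simp add: exp_add[symmetric] mult.assoc[symmetric]) (simp add: field_simps)
    also have "\<dots> \<le> exp (\<epsilon> / 2 * t) * exp (\<epsilon> / 2 * t)"
      using * by (intro mult_left_mono) auto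
    finally show ?case by (simp add: exp_add[symmetric])
  qed
qed

lemma regvar_class_ln_over_tendsto:
  assumes g: "regvar_class rho g"
  shows "((\<lambda>t. ln (g t) / t) \<longlongrightarrow> 0) at_top"
proof (rule order_tendstoI)
  have g1: "\<forall>\<^sub>F t in at_top. g t > 1"
    using regvar_class_at_top[OF g] by (simp add: filterlim_at_top_dense)
  {
    fix b :: real assume "b < 0"
    show "\<forall>\<^sub>F t in at_top. b < ln (g t) / t"
      using g1 eventually_gt_at_top[of 0]
    proof eventually_elim
      case (elim t)
      then have "0 \<le> ln (g t) / t" by simp
      with \<open>b < 0\<close> show ?case by linarith
    qed
  next
    fix b :: real assume b: "0 < b"
    then have "b / 2 > 0" by simp
    from g1 eventually_gt_at_top[of 0] regvar_class_subexponential[OF g this]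
    show "\<forall>\<^sub>F t in at_top. ln (g t) / t < b"
    proof eventually_elim
      case (elim t)
      then have "ln (g t) \<le> b / 2 * t" by (subst ln_le_iff_le_exp) auto
      also have "\<dots> < b * t" using b elim by simp
      finally show ?case using elim by (simp add: field_simps)
    qed
  }
qed

text \<open>The error term is negligible because \<open>ln (g s) = o(s)\<close>.\<close>

lemma regvar_class_scale:
  assumes g: "regvar_class rho g" and a: "a > 0"
    and f: "filterlim f at_top F" and h: "\<forall>\<^sub>F z in F. h z > 0"
    and bound: "\<forall>\<^sub>F z in F. \<bar>ln (h z) - a * ln (f z)\<bar> \<le> ln (g (ln (f z))) + K"
  shows "((\<lambda>z. g (ln (h z)) / g (ln (f z))) \<longlongrightarrow> a powr rho) F"
    and "filterlim h at_top F"
proof -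
  have lnf: "filterlim (\<lambda>z. ln (f z)) at_top F"
    using f by (rule filterlim_compose[OF ln_at_top])
  have 0: "((\<lambda>z. ln (g (ln (f z))) / ln (f z) + K * inverse (ln (f z))) \<longlongrightarrow> 0 + K * 0) F"
    by (intro tendsto_intros filterlim_compose[OF regvar_class_ln_over_tendsto[OF g] lnf]
        filterlim_compose[OF tendsto_inverse_0_at_top[OF filterlim_ident] lnf])
  have "((\<lambda>z. ln (h z) / ln (f z) - a) \<longlongrightarrow> 0) F"
  proof (rule Lim_null_comparison)
    show "\<forall>\<^sub>F z in F. norm (ln (h z) / ln (f z) - a) \<le>
        ln (g (ln (f z))) / ln (f z) + K * inverse (ln (f z))"
      using bound lnf[unfolded filterlim_at_top_dense, rule_format, of 0]
    proof eventually_elim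
      case (elim z)
      have "ln (h z) / ln (f z) - a = (ln (h z) - a * ln (f z)) / ln (f z)"
        using elim by (simp add: field_simps)
      then show ?case using elim by (simp add: field_simps)
    qed
  qed (use 0 in simp)
  then have lim: "((\<lambda>z. ln (h z) / ln (f z)) \<longlongrightarrow> a) F"
    by (simp add: LIM_zero_iff)
  from regvar_class_ratio_tendsto[OF g lnf this a]
  show "((\<lambda>z. g (ln (h z)) / g (ln (f z))) \<longlongrightarrow> a powr rho) F" .
  have "filterlim (\<lambda>z. ln (h z) / ln (f z) * ln (f z)) at_top F"
    by (rule filterlim_tendsto_pos_mult_at_top[OF lim a lnf])
  then have "filterlim (\<lambda>z. exp (ln (h z) / ln (f z) * ln (f z))) at_top F"
    by (rule filterlim_compose[OF exp_at_top])
  then show "filterlim h at_top F"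
  proof (rule filterlim_mono_eventually)
    show "\<forall>\<^sub>F z in F. exp (ln (h z) / ln (f z) * ln (f z)) = h z"
      using h lnf[unfolded filterlim_at_top_dense, rule_format, of 0]
      by eventually_elim simp
  qed auto
qed

text \<open>As \<beta> is asymptotically q times \<alpha>, the exponent grows linearly in \<alpha>
  and beats any linear prefactor. In the applications \<alpha> and \<beta> are g at the logarithms
  of n and of the matching t, in either order.\<close>

lemma linear_le_exp_eventually:
  fixes \<alpha> \<beta> :: "'b \<Rightarrow> real"
  assumes \<alpha>: "filterlim \<alpha> at_top F" and lim: "((\<lambda>z. \<beta> z / \<alpha> z) \<longlongrightarrow> q) F" and pq: "p' * q < p"
  shows "\<forall>\<^sub>F z in F. K * \<alpha> z \<le> exp (p * \<alpha> z - p' * \<beta> z)"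
proof -
  define d where "d = (p - p' * q) / 2"
  have d: "d > 0" using pq by (simp add: d_def)
  have "((\<lambda>z. p - p' * (\<beta> z / \<alpha> z)) \<longlongrightarrow> p - p' * q) F"
    by (intro tendsto_intros lim)
  then have 1: "\<forall>\<^sub>F z in F. p - p' * (\<beta> z / \<alpha> z) > d"
    by (rule order_tendstoD) (use pq in \<open>simp add: d_def field_simps\<close>)
  have "((\<lambda>x::real. x ^ 1 / exp x) \<longlongrightarrow> 0) at_top" by (rule tendsto_power_div_exp_0)
  moreover have "filterlim (\<lambda>z. d * \<alpha> z) at_top F"
    by (rule filterlim_tendsto_pos_mult_at_top[OF tendsto_const d \<alpha>])
  ultimately have "((\<lambda>z. (d * \<alpha> z) ^ 1 / exp (d * \<alpha> z)) \<longlongrightarrow> 0) F"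
    by (rule filterlim_compose)
  then have "((\<lambda>z. K / d * ((d * \<alpha> z) ^ 1 / exp (d * \<alpha> z))) \<longlongrightarrow> K / d * 0) F"
    by (intro tendsto_intros)
  then have "\<forall>\<^sub>F z in F. K / d * ((d * \<alpha> z) ^ 1 / exp (d * \<alpha> z)) < 1"
    by (rule order_tendstoD) simp
  then show ?thesis
    using 1 \<alpha>[unfolded filterlim_at_top_dense, rule_format, of 0]
  proof eventually_elim
    case (elim z)
    have "K * \<alpha> z \<le> exp (d * \<alpha> z)"
      using elim d by (simp add: field_simps)
    also have "d * \<alpha> z \<le> p * \<alpha> z - p' * \<beta> z"
      using elim by (simp add: field_simps)
    finally show ?case by simp
  qed
qed

section \<open>Logarithmic rates as eventual or frequent exponential bounds\<close>

lemma
  assumes "w > 0"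
  shows elog_divide_le_iff: "elog p / ereal w \<le> ereal s \<longleftrightarrow> p \<le> exp (s * w)"
    and elog_divide_less_iff: "elog p / ereal w < ereal s \<longleftrightarrow> p < exp (s * w)"
proof -
  have "elog p / ereal w = (if p > 0 then ereal (ln p / w) else - \<infinity>)"
    using assms by (simp add: elog_def divide_ereal_def divide_inverse)
  \<comment> \<open>For nonpositive p the rate is minus infinity, so the left sides hold; these
    facts supply the right sides.\<close>
  moreover have "p \<le> exp (s * w)" "p < exp (s * w)" if "\<not> p > 0"
    using that exp_gt_zero[of "s * w"] by linarith+
  moreover have "ln p / w \<le> s \<longleftrightarrow> p \<le> exp (s * w)" "ln p / w < s \<longleftrightarrow> p < exp (s * w)" if "p > 0"
  proof -
    have "ln p / w \<le> s \<longleftrightarrow> ln p \<le> s * w" "ln p / w < s \<longleftrightarrow> ln p < s * w"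
      using assms by (simp_all add: pos_divide_le_eq pos_divide_less_eq)
    then show "ln p / w \<le> s \<longleftrightarrow> p \<le> exp (s * w)" "ln p / w < s \<longleftrightarrow> p < exp (s * w)"
      using that exp_le_cancel_iff[of "ln p" "s * w"] exp_less_cancel_iff[of "ln p" "s * w"] by auto
  qed
  ultimately show "elog p / ereal w \<le> ereal s \<longleftrightarrow> p \<le> exp (s * w)"
    "elog p / ereal w < ereal s \<longleftrightarrow> p < exp (s * w)"
    by auto
qed

lemma
  shows less_uminus_ereal_iff: "ereal \<kappa> < - y \<longleftrightarrow> y < ereal (- \<kappa>)"
    and uminus_less_ereal_iff: "- y < ereal \<kappa> \<longleftrightarrow> ereal (- \<kappa>) < y"
    and le_uminus_ereal_iff: "ereal \<kappa> \<le> - y \<longleftrightarrow> y \<le> ereal (- \<kappa>)"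
    and uminus_le_ereal_iff: "- y \<le> ereal \<kappa> \<longleftrightarrow> ereal (- \<kappa>) \<le> y"
  by (cases y; auto)+

lemma ereal_le_real_denseI:
  assumes "\<And>\<kappa>. ereal \<kappa> < m \<Longrightarrow> ereal \<kappa> \<le> y"
  shows "m \<le> y"
proof (rule ccontr)
  assume "\<not> m \<le> y"
  then have "y < m" by simp
  from ereal_dense2[OF this] obtain \<kappa> where "y < ereal \<kappa>" "ereal \<kappa> < m" by blast
  with assms[of \<kappa>] show False by simp
qed

lemma ereal_ge_real_denseI:
  assumes "\<And>\<kappa>. m < ereal \<kappa> \<Longrightarrow> y \<le> ereal \<kappa>"
  shows "y \<le> m"
proof (rule ccontr)
  assume "\<not> y \<le> m"
  then have "m < y" by simp
  from ereal_dense2[OF this] obtain \<kappa> where "m < ereal \<kappa>" "ereal \<kappa> < y" by blast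
  with assms[of \<kappa>] show False by simp
qed

context
  fixes F :: "'b filter" and p w :: "'b \<Rightarrow> real"
  assumes F: "F \<noteq> bot" and w: "\<forall>\<^sub>F z in F. w z > 0"
begin

private abbreviation "r \<equiv> \<lambda>z. elog (p z) / ereal (w z)"

lemma elog_rate_le_iff: "(\<forall>\<^sub>F z in F. r z \<le> ereal (- \<kappa>)) \<longleftrightarrow> (\<forall>\<^sub>F z in F. p z \<le> exp (- (\<kappa> * w z)))"
  by (rule eventually_cong[OF w]) (simp add: elog_divide_le_iff)

lemma elog_rate_less_iff: "(\<forall>\<^sub>F z in F. r z < ereal (- \<kappa>)) \<longleftrightarrow> (\<forall>\<^sub>F z in F. p z < exp (- (\<kappa> * w z)))"
  by (rule eventually_cong[OF w]) (simp add: elog_divide_less_iff)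

lemma elog_rate_ge_iff: "(\<forall>\<^sub>F z in F. r z \<ge> ereal (- \<kappa>)) \<longleftrightarrow> (\<forall>\<^sub>F z in F. p z \<ge> exp (- (\<kappa> * w z)))"
  by (rule eventually_cong[OF w]) (simp only: not_less[symmetric] elog_divide_less_iff mult_minus_left simp_thms)

lemma elog_rate_gt_iff: "(\<forall>\<^sub>F z in F. r z > ereal (- \<kappa>)) \<longleftrightarrow> (\<forall>\<^sub>F z in F. p z > exp (- (\<kappa> * w z)))"
  by (rule eventually_cong[OF w]) (use elog_divide_le_iff[of _ _ "- \<kappa>"] in \<open>auto simp only: not_le[symmetric] mult_minus_left\<close>)

text \<open>First of eight rules. The four eliminations will be applied to the tail as t tends to
  infinity, the four introductions to the deviation probabilities as n does. Bounds on an upper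
  limit from above and on a lower limit from below are eventual; the other two kinds are
  frequent.\<close>

lemma less_uminus_Limsup_elogD:
  assumes "ereal \<kappa> < - Limsup F r"
  shows "\<forall>\<^sub>F z in F. p z \<le> exp (- (\<kappa> * w z))"
proof -
  have "Limsup F r < ereal (- \<kappa>)"
    using assms by (simp add: less_uminus_ereal_iff)
  from Limsup_lessD[OF this] show ?thesis
    unfolding elog_rate_less_iff by eventually_elim simp
qed

lemma uminus_Limsup_elog_lessD:
  assumes "- Limsup F r < ereal \<kappa>"
  shows "\<exists>\<^sub>F z in F. p z \<ge> exp (- (\<kappa> * w z))"
proof (rule ccontr)
  assume "\<not> ?thesis"
  then have "\<forall>\<^sub>F z in F. p z \<le> exp (- (\<kappa> * w z))"
    by (auto simp: frequently_def not_le elim: eventually_mono)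
  then have "Limsup F r \<le> ereal (- \<kappa>)"
    unfolding elog_rate_le_iff[symmetric] by (rule Limsup_bounded)
  then show False
    using assms by (simp add: uminus_less_ereal_iff)
qed

lemma less_uminus_Liminf_elogD:
  assumes "ereal \<kappa> < - Liminf F r"
  shows "\<exists>\<^sub>F z in F. p z \<le> exp (- (\<kappa> * w z))"
proof (rule ccontr)
  assume "\<not> ?thesis"
  then have "\<forall>\<^sub>F z in F. p z \<ge> exp (- (\<kappa> * w z))"
    by (auto simp: frequently_def not_le elim: eventually_mono)
  then have "Liminf F r \<ge> ereal (- \<kappa>)"
    unfolding elog_rate_ge_iff[symmetric] by (rule Liminf_bounded)
  then show False
    using assms by (simp add: less_uminus_ereal_iff)
qed

lemma uminus_Liminf_elog_lessD:
  assumes "- Liminf F r < ereal \<kappa>"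
  shows "\<forall>\<^sub>F z in F. p z \<ge> exp (- (\<kappa> * w z))"
proof -
  have "ereal (- \<kappa>) < Liminf F r"
    using assms by (simp add: uminus_less_ereal_iff)
  from less_LiminfD[OF this] show ?thesis
    unfolding elog_rate_gt_iff by eventually_elim simp
qed

lemma le_uminus_Limsup_elogI:
  assumes "\<And>\<kappa>. ereal \<kappa> < m \<Longrightarrow> \<forall>\<^sub>F z in F. p z \<le> exp (- (\<kappa> * w z))"
  shows "m \<le> - Limsup F r"
proof (rule ereal_le_real_denseI)
  fix \<kappa> assume "ereal \<kappa> < m"
  from assms[OF this] have "Limsup F r \<le> ereal (- \<kappa>)"
    unfolding elog_rate_le_iff[symmetric] by (rule Limsup_bounded)
  then show "ereal \<kappa> \<le> - Limsup F r"
    by (simp add: le_uminus_ereal_iff)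
qed

lemma uminus_Limsup_elog_leI:
  assumes "\<And>\<kappa>. m < ereal \<kappa> \<Longrightarrow> \<exists>\<^sub>F z in F. p z \<ge> exp (- (\<kappa> * w z))"
  shows "- Limsup F r \<le> m"
proof (rule ccontr)
  assume "\<not> ?thesis"
  then have "m < - Limsup F r" by simp
  then obtain \<kappa> where \<kappa>: "m < ereal \<kappa>" "ereal \<kappa> < - Limsup F r"
    using ereal_dense2 by blast
  have "Limsup F r < ereal (- \<kappa>)"
    using \<kappa>(2) by (simp add: less_uminus_ereal_iff)
  from Limsup_lessD[OF this] have "\<forall>\<^sub>F z in F. p z < exp (- (\<kappa> * w z))"
    unfolding elog_rate_less_iff .
  with assms[OF \<kappa>(1)] show False
    by (simp add: frequently_def not_le)
qed

lemma le_uminus_Liminf_elogI: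
  assumes "\<And>\<kappa>. ereal \<kappa> < m \<Longrightarrow> \<exists>\<^sub>F z in F. p z \<le> exp (- (\<kappa> * w z))"
  shows "m \<le> - Liminf F r"
proof (rule ccontr)
  assume "\<not> ?thesis"
  then have "- Liminf F r < m" by simp
  then obtain \<kappa> where \<kappa>: "- Liminf F r < ereal \<kappa>" "ereal \<kappa> < m"
    using ereal_dense2 by blast
  have "ereal (- \<kappa>) < Liminf F r"
    using \<kappa>(1) by (simp add: uminus_less_ereal_iff)
  from less_LiminfD[OF this] have "\<forall>\<^sub>F z in F. p z > exp (- (\<kappa> * w z))"
    unfolding elog_rate_gt_iff .
  with assms[OF \<kappa>(2)] show False
    by (simp add: frequently_def not_le)
qed

lemma uminus_Liminf_elog_leI:
  assumes "\<And>\<kappa>. m < ereal \<kappa> \<Longrightarrow> \<forall>\<^sub>F z in F. p z \<ge> exp (- (\<kappa> * w z))"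
  shows "- Liminf F r \<le> m"
proof (rule ereal_ge_real_denseI)
  fix \<kappa> assume "m < ereal \<kappa>"
  from assms[OF this] have "Liminf F r \<ge> ereal (- \<kappa>)"
    unfolding elog_rate_ge_iff[symmetric] by (rule Liminf_bounded)
  then show "- Liminf F r \<le> ereal \<kappa>"
    by (simp add: uminus_le_ereal_iff)
qed

end

section \<open>The scales in n and their inverses\<close>

lemma regvar_class_ln_at_top:
  "regvar_class rho g \<Longrightarrow> filterlim f at_top F \<Longrightarrow> filterlim (\<lambda>z. g (ln (f z))) at_top F"
  using filterlim_compose[OF regvar_class_at_top filterlim_compose[OF ln_at_top]] by blast

text \<open>Growth exponent 1/2 at ln n gives G(n) <= sqrt n. The limit is what makes the block
  lengths in the Gaussian lower bound tend to infinity.\<close>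

lemma regvar_class_ln_over_n:
  assumes g: "regvar_class rho g"
  shows "(\<lambda>n. g (ln (real n)) / real n) \<longlonglongrightarrow> 0"
proof (rule Lim_null_comparison)
  have ln_n: "filterlim (\<lambda>n. ln (real n)) at_top sequentially"
    by (rule filterlim_compose[OF ln_at_top filterlim_real_sequentially])
  show "\<forall>\<^sub>F n in sequentially. norm (g (ln (real n)) / real n) \<le> 1 / sqrt (real n)"
    using eventually_compose_filterlim[OF regvar_class_subexponential[OF g half_gt_zero[OF zero_less_one]] ln_n]
      regvar_class_ln_at_top[OF g filterlim_real_sequentially,
        unfolded filterlim_at_top_dense, rule_format, of 0]
      eventually_gt_at_top[of 0]
  proof eventually_elim
    case (elim n)
    have "exp (1 / 2 * ln (real n)) = sqrt (real n)"
      using elim by (simp add: powr_half_sqrt[symmetric] powr_def)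
    then have "g (ln (real n)) / real n \<le> sqrt (real n) / real n"
      using elim by (intro divide_right_mono) auto
    also have "\<dots> = 1 / sqrt (real n)"
      by (simp add: sqrt_divide_self_eq inverse_eq_divide)
    finally show ?case using elim by simp
  qed
  show "(\<lambda>n. 1 / sqrt (real n)) \<longlonglongrightarrow> 0"
    by (rule tendsto_divide_0[OF tendsto_const filterlim_at_top_imp_at_infinity[
        OF filterlim_compose[OF sqrt_at_top filterlim_real_sequentially]]])
qed

locale regvar_scale =
  fixes g :: "real \<Rightarrow> real" and rho :: real
  assumes g: "regvar_class rho g"
begin

abbreviation G :: "nat \<Rightarrow> real" where "G n \<equiv> g (ln (real n))"

abbreviation c :: real where "c \<equiv> 2 powr rho"

lemma c_pos: "ereal c > 0" "ereal c \<noteq> \<infinity>" by simp_all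

lemma G_at_top: "filterlim G at_top sequentially"
  by (rule regvar_class_ln_at_top[OF g filterlim_real_sequentially])

lemma G_gt: "\<forall>\<^sub>F n in sequentially. G n > K"
  using G_at_top by (simp add: filterlim_at_top_dense)

lemma gln_at_top: "filterlim (\<lambda>t. g (ln t)) at_top at_top"
  by (rule regvar_class_ln_at_top[OF g filterlim_ident])

lemma gln_gt: "\<forall>\<^sub>F t in at_top. g (ln t) > K"
  using gln_at_top by (simp add: filterlim_at_top_dense)

lemma scale_down:
  assumes "C > 0"
  defines "h \<equiv> \<lambda>n. C * sqrt (real n / G n)"
  shows "((\<lambda>n. g (ln (h n)) / G n) \<longlongrightarrow> 1 / c) sequentially"
    and "filterlim h at_top sequentially"
proof -
  have 1: "\<forall>\<^sub>F n in sequentially. h n > 0"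
    using G_gt[of 1] eventually_gt_at_top[of 0] by eventually_elim (use assms in simp)
  have 2: "\<forall>\<^sub>F n in sequentially. \<bar>ln (h n) - 1 / 2 * ln (real n)\<bar> \<le> ln (G n) + \<bar>ln C\<bar>"
    using G_gt[of 1] eventually_gt_at_top[of 0]
  proof eventually_elim
    case (elim n)
    then have "ln (h n) = ln C + (ln (real n) - ln (G n)) / 2"
      using assms by (simp add: ln_mult ln_sqrt ln_div)
    moreover have "ln (G n) \<ge> 0" using elim by simp
    ultimately show ?case
      by (intro abs_leI) (use abs_ge_self[of "ln C"] abs_ge_minus_self[of "ln C"] in \<open>simp_all add: field_simps\<close>)
  qed
  note S = regvar_class_scale[OF g _ filterlim_real_sequentially 1 2]
  show "((\<lambda>n. g (ln (h n)) / G n) \<longlongrightarrow> 1 / c) sequentially"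
    using S(1) by (simp add: powr_divide)
  show "filterlim h at_top sequentially" using S(2) by simp
qed

lemma scale_up:
  assumes "C > 0"
  defines "h \<equiv> \<lambda>n. C * sqrt (real n * G n)"
  shows "((\<lambda>n. g (ln (h n)) / G n) \<longlongrightarrow> 1 / c) sequentially"
    and "filterlim h at_top sequentially"
proof -
  have 1: "\<forall>\<^sub>F n in sequentially. h n > 0"
    using G_gt[of 1] eventually_gt_at_top[of 0] by eventually_elim (use assms in simp)
  have 2: "\<forall>\<^sub>F n in sequentially. \<bar>ln (h n) - 1 / 2 * ln (real n)\<bar> \<le> ln (G n) + \<bar>ln C\<bar>"
    using G_gt[of 1] eventually_gt_at_top[of 0]
  proof eventually_elim
    case (elim n)
    then have "ln (h n) = ln C + (ln (real n) + ln (G n)) / 2"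
      using assms by (simp add: ln_mult ln_sqrt)
    moreover have "ln (G n) \<ge> 0" using elim by simp
    ultimately show ?case
      by (intro abs_leI) (use abs_ge_self[of "ln C"] abs_ge_minus_self[of "ln C"] in \<open>simp_all add: field_simps\<close>)
  qed
  note S = regvar_class_scale[OF g _ filterlim_real_sequentially 1 2]
  show "((\<lambda>n. g (ln (h n)) / G n) \<longlongrightarrow> 1 / c) sequentially"
    using S(1) by (simp add: powr_divide)
  show "filterlim h at_top sequentially" using S(2) by simp
qed

text \<open>Inverts C sqrt(n / G(n)): for a suitable K, this scale at the index \<open>N t\<close>
  has reached t. There the tail is at most \<open>T t\<close>, so smallness at t is
  inherited.\<close>

lemma index_up:
  assumes "K > 0"
  defines "N \<equiv> \<lambda>t. nat \<lceil>K * t\<^sup>2 * g (ln t)\<rceil>"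
  shows "((\<lambda>t. G (N t) / g (ln t)) \<longlongrightarrow> c) at_top"
    and "filterlim N sequentially at_top"
    and "\<forall>\<^sub>F t in at_top. K * t\<^sup>2 * g (ln t) \<le> real (N t) \<and> real (N t) \<le> 2 * K * t\<^sup>2 * g (ln t)"
proof -
  show bounds: "\<forall>\<^sub>F t in at_top. K * t\<^sup>2 * g (ln t) \<le> real (N t) \<and> real (N t) \<le> 2 * K * t\<^sup>2 * g (ln t)"
    \<comment> \<open>These two bounds make the rounded quantity at least 1, so that the ceiling at
      most doubles it.\<close>
    using gln_gt[of "1 / K"] eventually_ge_at_top[of 1]
  proof eventually_elim
    case (elim t)
    have "1 * 1 \<le> t\<^sup>2 * (K * g (ln t))"
      using elim assms(1) by (intro mult_mono) (auto simp: field_simps)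
    then have ge1: "K * t\<^sup>2 * g (ln t) \<ge> 1" by (simp add: mult_ac)
    then have "real (N t) = of_int \<lceil>K * t\<^sup>2 * g (ln t)\<rceil>" by (simp add: N_def of_nat_nat)
    then show ?case using ge1 by linarith
  qed
  have 1: "\<forall>\<^sub>F t in at_top. real (N t) > 0"
    using bounds gln_gt[of 0] eventually_gt_at_top[of 0]
  proof eventually_elim
    case (elim t)
    then have "K * t\<^sup>2 * g (ln t) > 0" using assms(1) by simp
    then show ?case using elim by linarith
  qed
  have 2: "\<forall>\<^sub>F t in at_top. \<bar>ln (real (N t)) - 2 * ln t\<bar> \<le> ln (g (ln t)) + (\<bar>ln K\<bar> + ln 2)"
    using bounds 1 gln_gt[of 1] eventually_gt_at_top[of 0]
  proof eventually_elim
    case (elim t)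
    have "ln (K * t\<^sup>2 * g (ln t)) \<le> ln (real (N t))" "ln (real (N t)) \<le> ln (2 * K * t\<^sup>2 * g (ln t))"
      using elim assms(1) by (subst ln_le_cancel_iff; simp)+
    moreover have "ln (K * t\<^sup>2 * g (ln t)) = ln K + 2 * ln t + ln (g (ln t))"
      "ln (2 * K * t\<^sup>2 * g (ln t)) = ln 2 + ln K + 2 * ln t + ln (g (ln t))"
      using elim assms(1) by (simp_all add: ln_mult ln_realpow)
    moreover have "ln (g (ln t)) \<ge> 0" using elim by simp
    moreover have "ln (2::real) \<ge> 0" by simp
    ultimately show ?case by linarith
  qed
  note S = regvar_class_scale[OF g _ filterlim_ident 1 2]
  show "((\<lambda>t. G (N t) / g (ln t)) \<longlongrightarrow> c) at_top" using S(1) by simp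
  show "filterlim N sequentially at_top"
    using S(2) by (simp add: filterlim_sequentially_iff_filterlim_real)
qed

text \<open>Inverts C sqrt(n G(n)): for a suitable K, this scale at the index \<open>N t\<close>
  does not exceed t. There the tail is at least \<open>T t\<close>, so largeness at t is
  inherited.\<close>

lemma index_down:
  assumes "K > 0"
  defines "N \<equiv> \<lambda>t. nat \<lfloor>t\<^sup>2 / (K * g (ln t))\<rfloor>"
  shows "((\<lambda>t. G (N t) / g (ln t)) \<longlongrightarrow> c) at_top"
    and "filterlim N sequentially at_top"
    and "\<forall>\<^sub>F t in at_top. t\<^sup>2 / (2 * K * g (ln t)) \<le> real (N t) \<and> real (N t) \<le> t\<^sup>2 / (K * g (ln t))"
proof -
  show bounds: "\<forall>\<^sub>F t in at_top. t\<^sup>2 / (2 * K * g (ln t)) \<le> real (N t) \<and> real (N t) \<le> t\<^sup>2 / (K * g (ln t))"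
    using gln_gt[of 0] eventually_gt_at_top[of 0] eventually_ge_at_top[of "2 * K"]
      eventually_compose_filterlim[OF regvar_class_subexponential[OF g zero_less_one] ln_at_top]
  proof eventually_elim
    case (elim t)
    \<comment> \<open>Subexponential growth with exponent 1 at ln t reads g (ln t) <= t. The rounded
      quantity is therefore at least 2, and the floor at most halves it.\<close>
    then have "2 * K * g (ln t) \<le> t * t" using assms(1) by (intro mult_mono) auto
    then have ge: "t\<^sup>2 / (K * g (ln t)) \<ge> 2"
      using elim assms(1) by (simp add: field_simps power2_eq_square)
    have "y / 2 \<le> real (nat \<lfloor>y\<rfloor>) \<and> real (nat \<lfloor>y\<rfloor>) \<le> y" if "y \<ge> 2" for y :: real
    proof -
      from that have "real (nat \<lfloor>y\<rfloor>) = of_int \<lfloor>y\<rfloor>" by (simp add: of_nat_nat)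
      then show ?thesis using that by linarith
    qed
    from this[OF ge] have "t\<^sup>2 / (K * g (ln t)) / 2 \<le> real (N t) \<and> real (N t) \<le> t\<^sup>2 / (K * g (ln t))"
      unfolding N_def .
    moreover have "t\<^sup>2 / (2 * K * g (ln t)) = t\<^sup>2 / (K * g (ln t)) / 2" by simp
    ultimately show ?case by (simp only:)
  qed
  have 1: "\<forall>\<^sub>F t in at_top. real (N t) > 0"
    using bounds gln_gt[of 0] eventually_gt_at_top[of 0]
  proof eventually_elim
    case (elim t)
    then have "t\<^sup>2 / (2 * K * g (ln t)) > 0" using assms(1) by simp
    then show ?case using elim by linarith
  qed
  have 2: "\<forall>\<^sub>F t in at_top. \<bar>ln (real (N t)) - 2 * ln t\<bar> \<le> ln (g (ln t)) + (\<bar>ln K\<bar> + ln 2)"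
    using bounds 1 gln_gt[of 1] eventually_gt_at_top[of 0]
  proof eventually_elim
    case (elim t)
    have "ln (t\<^sup>2 / (2 * K * g (ln t))) \<le> ln (real (N t))" "ln (real (N t)) \<le> ln (t\<^sup>2 / (K * g (ln t)))"
      using elim assms(1) by (subst ln_le_cancel_iff; simp)+
    moreover have "ln (t\<^sup>2 / (K * g (ln t))) = 2 * ln t - ln K - ln (g (ln t))"
      "ln (t\<^sup>2 / (2 * K * g (ln t))) = 2 * ln t - ln 2 - ln K - ln (g (ln t))"
      using elim assms(1) by (simp_all add: ln_mult ln_realpow ln_div)
    moreover have "ln (g (ln t)) \<ge> 0" using elim by simp
    moreover have "ln (2::real) \<ge> 0" by simp
    ultimately show ?case by linarith
  qed
  note S = regvar_class_scale[OF g _ filterlim_ident 1 2]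
  show "((\<lambda>t. G (N t) / g (ln t)) \<longlongrightarrow> c) at_top" using S(1) by simp
  show "filterlim N sequentially at_top"
    using S(2) by (simp add: filterlim_sequentially_iff_filterlim_real)
qed

end

section \<open>Transfer from the tail of one summand to deviation probabilities\<close>

text \<open>The probabilistic input in abstract form. In \<open>upper\<close> the tail condition is
  a premise inside the eventual quantifier, so the bound holds at each large n that satisfies it,
  also when such n form only a subsequence. The free constants B, C and b make the hypotheses stable
  under addition and rescaling.\<close>

locale tail_transfer = regvar_scale g rho
  for g :: "real \<Rightarrow> real" and rho :: real +
  fixes T :: "real \<Rightarrow> real" and P :: "nat \<Rightarrow> real" and R :: real
  assumes T_mono: "\<And>s t. s \<le> t \<Longrightarrow> T t \<le> T s"
    and T_nonneg: "\<And>t. T t \<ge> 0"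
    and P_nonneg: "\<And>n. P n \<ge> 0"
    and P_le_1: "\<And>n. P n \<le> 1"
    and upper: "\<And>A. A > 0 \<Longrightarrow> \<exists>B>0. \<exists>C>0. \<forall>\<kappa>>0. \<forall>\<^sub>F n in sequentially.
        real n * T (C * sqrt (real n / G n)) \<le> exp (- (\<kappa> * G n)) \<longrightarrow>
        P n \<le> B * (exp (- (\<kappa> * G n)) + exp (1 - (2 - exp A) * R * G n))"
    and lower: "\<exists>C>0. \<exists>b>0. \<forall>\<^sub>F n in sequentially.
        P n \<ge> b * (real n * T (C * sqrt (real n * G n)))"
    and gauss: "\<And>R'. R' > R \<Longrightarrow> \<forall>\<^sub>F n in sequentially. P n \<ge> exp (- (R' * G n))"
begin

text \<open>A is chosen so that the Gaussian factor (2 - exp A) R equals \<kappa>', and \<kappa>' <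
  R makes it positive. The gap between \<kappa> and \<kappa>' absorbs the constant B (1 +
  e).\<close>

lemma upper_rate:
  assumes "0 < \<kappa>" "\<kappa> < \<kappa>'" "\<kappa>' < R"
  shows "\<exists>C>0. \<forall>\<^sub>F n in sequentially.
    real n * T (C * sqrt (real n / G n)) \<le> exp (- (\<kappa>' * G n)) \<longrightarrow> P n \<le> exp (- (\<kappa> * G n))"
proof -
  define A where "A = ln (2 - \<kappa>' / R)"
  have r: "0 < \<kappa>' / R" "\<kappa>' / R < 1" "R > 0" using assms by (auto simp: field_simps)
  have "2 - \<kappa>' / R > 1" using r by simp
  then have exp_A: "exp A = 2 - \<kappa>' / R" and "A > 0"
    unfolding A_def by (simp_all add: exp_ln)
  then have A: "A > 0" "(2 - exp A) * R = \<kappa>'" using r by simp_all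
  obtain B C where B: "B > 0" and C: "C > 0" "\<And>\<kappa>. \<kappa> > 0 \<Longrightarrow> \<forall>\<^sub>F n in sequentially.
      real n * T (C * sqrt (real n / G n)) \<le> exp (- (\<kappa> * G n)) \<longrightarrow>
      P n \<le> B * (exp (- (\<kappa> * G n)) + exp (1 - (2 - exp A) * R * G n))"
    using upper[OF A(1)] by blast
  have "\<forall>\<^sub>F n in sequentially. real n * T (C * sqrt (real n / G n)) \<le> exp (- (\<kappa>' * G n)) \<longrightarrow>
      P n \<le> exp (- (\<kappa> * G n))"
    using C(2)[OF less_trans[OF assms(1,2)]] G_gt[of "ln (B * (1 + exp 1)) / (\<kappa>' - \<kappa>)"]
  proof eventually_elim
    case (elim n)
    show ?case
    proof
      assume *: "real n * T (C * sqrt (real n / G n)) \<le> exp (- (\<kappa>' * G n))"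
      have "P n \<le> B * (exp (- (\<kappa>' * G n)) + exp (1 - \<kappa>' * G n))"
        using * elim(1) unfolding A(2) by blast
      also have "\<dots> = B * (1 + exp 1) * exp (- (\<kappa>' * G n))"
        by (simp add: exp_diff exp_minus field_simps)
      also have "B * (1 + exp 1) \<le> exp ((\<kappa>' - \<kappa>) * G n)"
      proof -
        have "ln (B * (1 + exp 1)) \<le> (\<kappa>' - \<kappa>) * G n"
          using elim(2) assms by (simp add: field_simps)
        moreover have "B * (1 + exp 1) > 0" using B by (intro mult_pos_pos add_pos_pos) auto
        ultimately show ?thesis using ln_le_iff_le_exp by blast
      qed
      also have "exp ((\<kappa>' - \<kappa>) * G n) * exp (- (\<kappa>' * G n)) = exp (- (\<kappa> * G n))"
        by (simp add: exp_add[symmetric] algebra_simps)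
      finally show "P n \<le> exp (- (\<kappa> * G n))" by simp
    qed
  qed
  with C(1) show ?thesis by blast
qed

text \<open>Disposes of the nonpositive rates, which \<open>upper_rate\<close> does not
  cover.\<close>

lemma eventually_P_le_exp_nonpos:
  assumes "\<kappa> \<le> 0"
  shows "\<forall>\<^sub>F n in sequentially. P n \<le> exp (- (\<kappa> * G n))"
  using G_gt[of 0]
proof eventually_elim
  case (elim n)
  have "1 \<le> exp (- (\<kappa> * G n))"
    using assms elim by (simp add: mult_nonpos_nonneg)
  then show ?case using P_le_1[of n] by linarith
qed

lemma less_divide_c_D:
  assumes "ereal \<kappa> < l / ereal c"
  shows "\<exists>\<kappa>'>\<kappa>. ereal (c * \<kappa>') < l"
proof -
  from ereal_dense2[OF assms] obtain \<kappa>' where "\<kappa> < \<kappa>'" "ereal \<kappa>' < l / ereal c" by auto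
  then show ?thesis by (auto simp: ereal_less_divide_pos[OF c_pos])
qed

lemma divide_c_less_D:
  assumes "l / ereal c < ereal \<kappa>"
  shows "\<exists>\<kappa>'<\<kappa>. l < ereal (c * \<kappa>')"
proof -
  from ereal_dense2[OF assms] obtain \<kappa>' where "\<kappa>' < \<kappa>" "l / ereal c < ereal \<kappa>'" by auto
  then show ?thesis by (auto simp: ereal_divide_less_pos[OF c_pos])
qed

lemma real_between:
  assumes "ereal \<kappa> < min (ereal R) m"
  shows "\<exists>\<kappa>'>\<kappa>. \<kappa>' < R \<and> ereal \<kappa>' < m"
  using ereal_dense2[OF assms] by auto

lemma not_bot: "sequentially \<noteq> bot" "(at_top :: real filter) \<noteq> bot"
  by simp_all

lemmas ldev_rules =
  le_uminus_Limsup_elogI[OF not_bot(1) G_gt] uminus_Limsup_elog_leI[OF not_bot(1) G_gt]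
  le_uminus_Liminf_elogI[OF not_bot(1) G_gt] uminus_Liminf_elog_leI[OF not_bot(1) G_gt]

lemmas tail_rules =
  less_uminus_Limsup_elogD[OF not_bot(2) gln_gt] uminus_Limsup_elog_lessD[OF not_bot(2) gln_gt]
  less_uminus_Liminf_elogD[OF not_bot(2) gln_gt] uminus_Liminf_elog_lessD[OF not_bot(2) gln_gt]

text \<open>At t = C sqrt(n / G(n)) the number n equals G(n) / C^2 times t^2, so n T(t) is t^2 T(t)
  up to a factor linear in G(n); this is where the weight t^2 comes from. Of the two gaps in
  \<kappa> < \<kappa>1 < \<kappa>2, the first pays for \<open>upper_rate\<close> and the second for
  the linear factor.\<close>

lemma le_uminus_limsup: "min (ereal R) (lam_over g T / ereal c) \<le> - limsup (ldev g P)"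
  unfolding ldev_def
proof (rule ldev_rules(1))
  fix \<kappa> assume \<kappa>: "ereal \<kappa> < min (ereal R) (lam_over g T / ereal c)"
  show "\<forall>\<^sub>F n in sequentially. P n \<le> exp (- (\<kappa> * G n))"
  proof (cases "\<kappa> \<le> 0")
    case False
    obtain \<kappa>1 where \<kappa>1: "\<kappa> < \<kappa>1" "\<kappa>1 < R" "ereal \<kappa>1 < lam_over g T / ereal c"
      using real_between[OF \<kappa>] by blast
    obtain \<kappa>2 where \<kappa>2: "\<kappa>1 < \<kappa>2" "ereal (c * \<kappa>2) < lam_over g T"
      using less_divide_c_D[OF \<kappa>1(3)] by blast
    obtain C where C: "C > 0" and PC: "\<forall>\<^sub>F n in sequentially.
        real n * T (C * sqrt (real n / G n)) \<le> exp (- (\<kappa>1 * G n)) \<longrightarrow> P n \<le> exp (- (\<kappa> * G n))"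
      using upper_rate[of \<kappa> \<kappa>1] False \<kappa>1 by auto
    define h where "h n = C * sqrt (real n / G n)" for n
    note S = scale_down[OF C, folded h_def]
    have "\<forall>\<^sub>F t in at_top. t\<^sup>2 * T t \<le> exp (- (c * \<kappa>2 * g (ln t)))"
      using \<kappa>2(2) unfolding lam_over_def by (rule tail_rules(1))
    note tail = eventually_compose_filterlim[OF this S(2)]
    have "\<forall>\<^sub>F n in sequentially. 1 / C\<^sup>2 * G n \<le> exp (- \<kappa>1 * G n - - (c * \<kappa>2) * g (ln (h n)))"
      using \<kappa>2 by (intro linear_le_exp_eventually[OF G_at_top S(1)]) auto
    then show ?thesis
      using tail PC G_gt[of 0] eventually_gt_at_top[of 0]
    proof eventually_elim
      case (elim n)
      have h2: "real n = G n / C\<^sup>2 * (h n)\<^sup>2"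
        using elim C by (simp add: h_def power_mult_distrib)
      have "real n * T (h n) = G n / C\<^sup>2 * ((h n)\<^sup>2 * T (h n))"
        by (subst h2) simp
      also have "\<dots> \<le> G n / C\<^sup>2 * exp (- (c * \<kappa>2 * g (ln (h n))))"
        using elim by (intro mult_left_mono) auto
      also have "\<dots> \<le> exp (- \<kappa>1 * G n - - (c * \<kappa>2) * g (ln (h n))) * exp (- (c * \<kappa>2 * g (ln (h n))))"
        using elim by (intro mult_right_mono) auto
      also have "\<dots> = exp (- (\<kappa>1 * G n))" by (simp add: exp_add[symmetric])
      finally show ?case using elim unfolding h_def by blast
    qed
  qed (rule eventually_P_le_exp_nonpos)
qed

text \<open>Here the tail is small only at certain arbitrarily large t. If P were too large at all
  large n, the tail condition of \<open>upper_rate\<close> would fail at all large n, in particular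
  at \<open>N t\<close> for every large t; hence the tail would be too large at every large
  t.\<close>

lemma le_uminus_liminf: "min (ereal R) (lam_under g T / ereal c) \<le> - liminf (ldev g P)"
  unfolding ldev_def
proof (rule ldev_rules(3))
  fix \<kappa> assume \<kappa>: "ereal \<kappa> < min (ereal R) (lam_under g T / ereal c)"
  show "\<exists>\<^sub>F n in sequentially. P n \<le> exp (- (\<kappa> * G n))"
  proof (cases "\<kappa> \<le> 0")
    case False
    obtain \<kappa>1 where \<kappa>1: "\<kappa> < \<kappa>1" "\<kappa>1 < R" "ereal \<kappa>1 < lam_under g T / ereal c"
      using real_between[OF \<kappa>] by blast
    obtain \<kappa>2 where \<kappa>2: "\<kappa>1 < \<kappa>2" "ereal (c * \<kappa>2) < lam_under g T"
      using less_divide_c_D[OF \<kappa>1(3)] by blast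
    obtain C where C: "C > 0" and PC: "\<forall>\<^sub>F n in sequentially.
        real n * T (C * sqrt (real n / G n)) \<le> exp (- (\<kappa>1 * G n)) \<longrightarrow> P n \<le> exp (- (\<kappa> * G n))"
      using upper_rate[of \<kappa> \<kappa>1] False \<kappa>1 by auto
    \<comment> \<open>Eventually G (N t) < 2 c g (ln t), since the ratio tends to c. With this K it
      follows that C sqrt(N t / G (N t)) >= t.\<close>
    define K where "K = 2 * c / C\<^sup>2"
    have K: "K > 0" using C by (simp add: K_def)
    define N where "N t = nat \<lceil>K * t\<^sup>2 * g (ln t)\<rceil>" for t
    note S = index_up[OF K, folded N_def]
    have ex: "\<exists>\<^sub>F t in at_top. t\<^sup>2 * T t \<le> exp (- (c * \<kappa>2 * g (ln t)))"
      using \<kappa>2(2) unfolding lam_under_def by (rule tail_rules(3))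
    have ev: "\<forall>\<^sub>F t in at_top. 2 * K * g (ln t) \<le> exp (c * \<kappa>2 * g (ln t) - \<kappa>1 * G (N t))"
      using \<kappa>2 by (intro linear_le_exp_eventually[OF gln_at_top S(1)]) (auto simp: mult.commute)
    have ratio: "\<forall>\<^sub>F t in at_top. G (N t) / g (ln t) < 2 * c"
      by (rule order_tendstoD(2)[OF S(1)]) simp
    have ratio': "\<forall>\<^sub>F t in at_top. G (N t) / g (ln t) > 0"
      by (rule order_tendstoD(1)[OF S(1)]) simp
    show ?thesis
    proof (rule ccontr)
      assume "\<not> ?thesis"
      then have "\<forall>\<^sub>F n in sequentially. \<not> P n \<le> exp (- (\<kappa> * G n))"
        by (simp add: frequently_def)
      with PC have "\<forall>\<^sub>F n in sequentially.
          \<not> real n * T (C * sqrt (real n / G n)) \<le> exp (- (\<kappa>1 * G n))"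
        by eventually_elim blast
      note bad = eventually_compose_filterlim[OF this S(2)]
      have "\<forall>\<^sub>F t in at_top. \<not> t\<^sup>2 * T t \<le> exp (- (c * \<kappa>2 * g (ln t)))"
        using bad ev ratio ratio' S(3) gln_gt[of 0] eventually_gt_at_top[of 0]
      proof eventually_elim
        case (elim t)
        have GN: "G (N t) > 0" "G (N t) < 2 * c * g (ln t)"
          using elim by (auto simp: zero_less_divide_iff divide_simps)
        show ?case
        proof
          assume *: "t\<^sup>2 * T t \<le> exp (- (c * \<kappa>2 * g (ln t)))"
          have "(t / C)\<^sup>2 * G (N t) \<le> (t / C)\<^sup>2 * (2 * c * g (ln t))"
            using GN by (intro mult_left_mono) auto
          also have "\<dots> = K * t\<^sup>2 * g (ln t)" by (simp add: K_def power_divide)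
          also have "\<dots> \<le> real (N t)" using elim by simp
          finally have "(t / C)\<^sup>2 \<le> real (N t) / G (N t)" using GN by (simp add: field_simps)
          then have "t / C \<le> sqrt (real (N t) / G (N t))" by (rule real_le_rsqrt)
          then have "t \<le> C * sqrt (real (N t) / G (N t))" using C by (simp add: field_simps)
          then have "real (N t) * T (C * sqrt (real (N t) / G (N t))) \<le> real (N t) * T t"
            by (intro mult_left_mono T_mono) auto
          also have "\<dots> = real (N t) / t\<^sup>2 * (t\<^sup>2 * T t)" using elim by simp
          also have "\<dots> \<le> real (N t) / t\<^sup>2 * exp (- (c * \<kappa>2 * g (ln t)))"
            using * by (intro mult_left_mono) auto
          also have "\<dots> \<le> 2 * K * g (ln t) * exp (- (c * \<kappa>2 * g (ln t)))"
            using elim by (intro mult_right_mono) (auto simp: divide_simps mult_ac)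
          also have "\<dots> \<le> exp (c * \<kappa>2 * g (ln t) - \<kappa>1 * G (N t)) * exp (- (c * \<kappa>2 * g (ln t)))"
            using elim by (intro mult_right_mono) auto
          also have "\<dots> = exp (- (\<kappa>1 * G (N t)))" by (simp add: exp_add[symmetric])
          finally show False using elim by simp
        qed
      qed
      with ex show False by (simp add: frequently_def)
    qed
  next
    case True
    show ?thesis
      using eventually_frequently[OF not_bot(1) eventually_P_le_exp_nonpos[OF True]] .
  qed
qed

lemma uminus_liminf_le: "- liminf (ldev g P) \<le> min (ereal R) (lam_under g T / ereal c)"
proof (rule min.boundedI)
  show "- liminf (ldev g P) \<le> ereal R"
    unfolding ldev_def by (rule ldev_rules(4)) (simp add: gauss)
  show "- liminf (ldev g P) \<le> lam_under g T / ereal c"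
    unfolding ldev_def
  proof (rule ldev_rules(4))
    fix \<kappa> assume "lam_under g T / ereal c < ereal \<kappa>"
    then obtain \<kappa>1 where \<kappa>1: "\<kappa>1 < \<kappa>" "lam_under g T < ereal (c * \<kappa>1)"
      using divide_c_less_D by blast
    obtain C b where C: "C > 0" "b > 0" and PC: "\<forall>\<^sub>F n in sequentially.
        P n \<ge> b * (real n * T (C * sqrt (real n * G n)))"
      using lower by blast
    define h where "h n = C * sqrt (real n * G n)" for n
    note S = scale_up[OF C(1), folded h_def]
    have "\<forall>\<^sub>F t in at_top. t\<^sup>2 * T t \<ge> exp (- (c * \<kappa>1 * g (ln t)))"
      using \<kappa>1(2) unfolding lam_under_def by (rule tail_rules(4))
    note tail = eventually_compose_filterlim[OF this S(2)]
    have "\<forall>\<^sub>F n in sequentially. C\<^sup>2 / b * G n \<le> exp (\<kappa> * G n - c * \<kappa>1 * g (ln (h n)))"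
      using \<kappa>1 by (intro linear_le_exp_eventually[OF G_at_top S(1)]) auto
    then show "\<forall>\<^sub>F n in sequentially. P n \<ge> exp (- (\<kappa> * G n))"
      using tail PC G_gt[of 0] eventually_gt_at_top[of 0]
    proof eventually_elim
      case (elim n)
      have h2: "real n = (h n)\<^sup>2 / (C\<^sup>2 * G n)"
        using elim C by (simp add: h_def power_mult_distrib)
      have "exp (- (\<kappa> * G n)) = exp (- (c * \<kappa>1 * g (ln (h n)))) / exp (\<kappa> * G n - c * \<kappa>1 * g (ln (h n)))"
        by (simp add: exp_diff[symmetric])
      also have "\<dots> \<le> (h n)\<^sup>2 * T (h n) / (C\<^sup>2 / b * G n)"
        using elim C by (intro frac_le) (auto intro: order_trans[OF exp_ge_zero])
      also have "\<dots> = b * (real n * T (h n))"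
        using elim C by (subst h2) (simp add: field_simps)
      also have "\<dots> \<le> P n" using elim unfolding h_def by simp
      finally show ?case .
    qed
  qed
qed

text \<open>The Gaussian half follows from the lower limit being at most the upper one. For the
  other half the tail is large only at certain arbitrarily large t, and \<open>N t\<close> carries
  each such t to an index where the one-jump bound is large.\<close>

lemma uminus_limsup_le: "- limsup (ldev g P) \<le> min (ereal R) (lam_over g T / ereal c)"
proof (rule min.boundedI)
  have "- limsup (ldev g P) \<le> - liminf (ldev g P)"
    by (simp add: Liminf_le_Limsup)
  also have "\<dots> \<le> ereal R" using uminus_liminf_le by simp
  finally show "- limsup (ldev g P) \<le> ereal R" .
  show "- limsup (ldev g P) \<le> lam_over g T / ereal c"
    unfolding ldev_def
  proof (rule ldev_rules(2))
    fix \<kappa> assume "lam_over g T / ereal c < ereal \<kappa>"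
    then obtain \<kappa>1 where \<kappa>1: "\<kappa>1 < \<kappa>" "lam_over g T < ereal (c * \<kappa>1)"
      using divide_c_less_D by blast
    obtain C b where C: "C > 0" "b > 0" and PC: "\<forall>\<^sub>F n in sequentially.
        P n \<ge> b * (real n * T (C * sqrt (real n * G n)))"
      using lower by blast
    \<comment> \<open>With G (N t) < 2 c g (ln t) and the upper bound on \<open>N t\<close>, this K
      gives C sqrt(N t * G (N t)) <= t.\<close>
    define K where "K = 2 * c * C\<^sup>2"
    have K: "K > 0" using C by (simp add: K_def)
    define N where "N t = nat \<lfloor>t\<^sup>2 / (K * g (ln t))\<rfloor>" for t
    note S = index_down[OF K, folded N_def]
    have ex: "\<exists>\<^sub>F t in at_top. t\<^sup>2 * T t \<ge> exp (- (c * \<kappa>1 * g (ln t)))"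
      using \<kappa>1(2) unfolding lam_over_def by (rule tail_rules(2))
    have ev: "\<forall>\<^sub>F t in at_top. 4 * K / b * g (ln t) \<le> exp (- (c * \<kappa>1) * g (ln t) - - \<kappa> * G (N t))"
      using \<kappa>1 by (intro linear_le_exp_eventually[OF gln_at_top S(1)]) (auto simp: mult.commute)
    have ratio: "\<forall>\<^sub>F t in at_top. G (N t) / g (ln t) < 2 * c"
      by (rule order_tendstoD(2)[OF S(1)]) simp
    have ratio': "\<forall>\<^sub>F t in at_top. G (N t) / g (ln t) > 0"
      by (rule order_tendstoD(1)[OF S(1)]) simp
    show "\<exists>\<^sub>F n in sequentially. P n \<ge> exp (- (\<kappa> * G n))"
    proof (rule ccontr)
      assume "\<not> ?thesis"
      then have "\<forall>\<^sub>F n in sequentially. \<not> P n \<ge> exp (- (\<kappa> * G n))"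
        by (simp add: frequently_def)
      with PC have "\<forall>\<^sub>F n in sequentially.
          b * (real n * T (C * sqrt (real n * G n))) < exp (- (\<kappa> * G n))"
        by eventually_elim simp
      note bad = eventually_compose_filterlim[OF this S(2)]
      have "\<forall>\<^sub>F t in at_top. \<not> t\<^sup>2 * T t \<ge> exp (- (c * \<kappa>1 * g (ln t)))"
        using bad ev ratio ratio' S(3) gln_gt[of 0] eventually_gt_at_top[of 0]
      proof eventually_elim
        case (elim t)
        show ?case
        proof
          assume *: "t\<^sup>2 * T t \<ge> exp (- (c * \<kappa>1 * g (ln t)))"
          have GN: "0 < G (N t)" "G (N t) < 2 * c * g (ln t)"
            using elim by (auto simp: zero_less_divide_iff divide_simps)
          have "real (N t) * G (N t) \<le> t\<^sup>2 / (K * g (ln t)) * (2 * c * g (ln t))"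
            using elim K GN by (intro mult_mono') auto
          also have "\<dots> = (t / C)\<^sup>2" using elim C by (simp add: K_def power_divide)
          finally have "sqrt (real (N t) * G (N t)) \<le> t / C"
            using elim C by (intro real_le_lsqrt) auto
          then have le: "C * sqrt (real (N t) * G (N t)) \<le> t" using C by (simp add: field_simps)
          have "exp (- (\<kappa> * G (N t))) = exp (- (c * \<kappa>1 * g (ln t))) /
              exp (- (c * \<kappa>1) * g (ln t) - - \<kappa> * G (N t))"
            by (simp add: exp_diff[symmetric])
          also have "\<dots> \<le> t\<^sup>2 * T t / (4 * K / b * g (ln t))"
            using elim C K * by (intro frac_le) (auto intro: order_trans[OF exp_ge_zero])
          also have "\<dots> \<le> b * (t\<^sup>2 / (2 * K * g (ln t)) * T t)"
          proof -
            have "T t * t\<^sup>2 \<ge> 0" using order_trans[OF exp_ge_zero *] by (simp only: mult.commute)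
            then show ?thesis using elim C K by (simp add: divide_simps)
          qed
          also have "\<dots> \<le> b * (real (N t) * T (C * sqrt (real (N t) * G (N t))))"
          proof -
            have "T t > 0" using * elim
              by (metis exp_gt_zero order_less_le_trans zero_less_mult_pos zero_less_power)
            then show ?thesis
              using elim C le by (intro mult_left_mono mult_mono T_mono) auto
          qed
          finally show False using elim by simp
        qed
      qed
      with ex show False by (simp add: frequently_def)
    qed
  qed
qed

lemma limsup_ldev: "limsup (ldev g P) = - min (ereal R) (lam_over g T / ereal c)"
  using antisym[OF uminus_limsup_le le_uminus_limsup] by (metis ereal_uminus_uminus)

lemma liminf_ldev: "liminf (ldev g P) = - min (ereal R) (lam_under g T / ereal c)"
  using antisym[OF uminus_liminf_le le_uminus_liminf] by (metis ereal_uminus_uminus)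

end

text \<open>Used for the absolute deviation. As the tails are nonincreasing, the smaller C serves
  both upper bounds and the larger C both jump bounds; for the Gaussian bound one of the two
  summands is enough.\<close>

lemma tail_transfer_add:
  assumes "tail_transfer g rho T1 P1 R" "tail_transfer g rho T2 P2 R"
    and le_1: "\<And>n. P1 n + P2 n \<le> 1"
  shows "tail_transfer g rho (\<lambda>t. T1 t + T2 t) (\<lambda>n. P1 n + P2 n) R"
proof -
  interpret t1: tail_transfer g rho T1 P1 R by fact
  interpret t2: tail_transfer g rho T2 P2 R by fact
  let ?G = "\<lambda>n. g (ln (real n))"
  show ?thesis
  proof
    fix A :: real assume "A > 0"
    obtain B1 C1 where 1: "B1 > 0" "C1 > 0" "\<And>\<kappa>. \<kappa> > 0 \<Longrightarrow> \<forall>\<^sub>F n in sequentially.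
        real n * T1 (C1 * sqrt (real n / ?G n)) \<le> exp (- (\<kappa> * ?G n)) \<longrightarrow>
        P1 n \<le> B1 * (exp (- (\<kappa> * ?G n)) + exp (1 - (2 - exp A) * R * ?G n))"
      using t1.upper[OF \<open>A > 0\<close>] by blast
    obtain B2 C2 where 2: "B2 > 0" "C2 > 0" "\<And>\<kappa>. \<kappa> > 0 \<Longrightarrow> \<forall>\<^sub>F n in sequentially.
        real n * T2 (C2 * sqrt (real n / ?G n)) \<le> exp (- (\<kappa> * ?G n)) \<longrightarrow>
        P2 n \<le> B2 * (exp (- (\<kappa> * ?G n)) + exp (1 - (2 - exp A) * R * ?G n))"
      using t2.upper[OF \<open>A > 0\<close>] by blast
    define C where "C = min C1 C2"
    have "\<forall>\<^sub>F n in sequentially.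
        real n * (T1 (C * sqrt (real n / ?G n)) + T2 (C * sqrt (real n / ?G n))) \<le> exp (- (\<kappa> * ?G n)) \<longrightarrow>
        P1 n + P2 n \<le> (B1 + B2) * (exp (- (\<kappa> * ?G n)) + exp (1 - (2 - exp A) * R * ?G n))"
      if "\<kappa> > 0" for \<kappa>
      using 1(3)[OF that] 2(3)[OF that] t1.G_gt[of 0]
    proof eventually_elim
      case (elim n)
      let ?s = "sqrt (real n / ?G n)"
      have s: "?s \<ge> 0" using elim by simp
      have "T1 (C1 * ?s) \<le> T1 (C * ?s)" "T2 (C2 * ?s) \<le> T2 (C * ?s)"
        by (intro t1.T_mono t2.T_mono mult_right_mono s; simp add: C_def)+
      with t1.T_nonneg[of "C * ?s"] t2.T_nonneg[of "C * ?s"]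
      have "T1 (C1 * ?s) \<le> T1 (C * ?s) + T2 (C * ?s)" "T2 (C2 * ?s) \<le> T1 (C * ?s) + T2 (C * ?s)"
        by linarith+
      then have "real n * T1 (C1 * ?s) \<le> real n * (T1 (C * ?s) + T2 (C * ?s))"
        "real n * T2 (C2 * ?s) \<le> real n * (T1 (C * ?s) + T2 (C * ?s))"
        by (intro mult_left_mono; simp)+
      with elim(1,2) show ?case
        unfolding distrib_right[of B1 B2] by (meson add_mono order_trans)
    qed
    then show "\<exists>B>0. \<exists>C>0. \<forall>\<kappa>>0. \<forall>\<^sub>F n in sequentially.
        real n * (T1 (C * sqrt (real n / ?G n)) + T2 (C * sqrt (real n / ?G n))) \<le> exp (- (\<kappa> * ?G n)) \<longrightarrow>
        P1 n + P2 n \<le> B * (exp (- (\<kappa> * ?G n)) + exp (1 - (2 - exp A) * R * ?G n))"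
      using 1 2 by (intro exI[of _ "B1 + B2"] exI[of _ C] conjI) (auto simp: C_def)
  next
    obtain C1 b1 where 1: "C1 > 0" "b1 > 0" "\<forall>\<^sub>F n in sequentially.
        P1 n \<ge> b1 * (real n * T1 (C1 * sqrt (real n * ?G n)))"
      using t1.lower by blast
    obtain C2 b2 where 2: "C2 > 0" "b2 > 0" "\<forall>\<^sub>F n in sequentially.
        P2 n \<ge> b2 * (real n * T2 (C2 * sqrt (real n * ?G n)))"
      using t2.lower by blast
    define C where "C = max C1 C2"
    define b where "b = min b1 b2"
    have "\<forall>\<^sub>F n in sequentially. P1 n + P2 n \<ge>
        b * (real n * (T1 (C * sqrt (real n * ?G n)) + T2 (C * sqrt (real n * ?G n))))"
      using 1(3) 2(3) t1.G_gt[of 0]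
    proof eventually_elim
      case (elim n)
      let ?s = "sqrt (real n * ?G n)"
      have s: "?s \<ge> 0" using elim by simp
      have T: "T1 (C * ?s) \<le> T1 (C1 * ?s)" "T2 (C * ?s) \<le> T2 (C2 * ?s)"
        by (intro t1.T_mono t2.T_mono mult_right_mono s; simp add: C_def)+
      have "b * (real n * T1 (C * ?s)) \<le> b1 * (real n * T1 (C1 * ?s))"
        "b * (real n * T2 (C * ?s)) \<le> b2 * (real n * T2 (C2 * ?s))"
        using 1 2 T by (intro mult_mono mult_left_mono; simp add: b_def t1.T_nonneg t2.T_nonneg)+
      with elim(1,2) show ?case by (simp add: ring_distribs)
    qed
    then show "\<exists>C>0. \<exists>b>0. \<forall>\<^sub>F n in sequentially. P1 n + P2 n \<ge>
        b * (real n * (T1 (C * sqrt (real n * ?G n)) + T2 (C * sqrt (real n * ?G n))))"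
      using 1 2 by (intro exI[of _ C] exI[of _ b] conjI) (auto simp: C_def b_def)
  next
    fix R' assume "R' > R"
    from t1.gauss[OF this] show "\<forall>\<^sub>F n in sequentially. P1 n + P2 n \<ge> exp (- (R' * ?G n))"
      by eventually_elim (use t2.P_nonneg in \<open>simp add: add_increasing2\<close>)
  qed (auto intro: add_mono t1.T_mono t2.T_mono add_nonneg_nonneg t1.T_nonneg t2.T_nonneg
      t1.P_nonneg t2.P_nonneg le_1)
qed

text \<open>A factor 2 in the argument of the tail disappears in the constants C. For large
  arguments it dominates any fixed shift, which is how the tail of the centered variable is replaced
  by the original one.\<close>

lemma tail_transfer_cong_scale:
  assumes "tail_transfer g rho T P R"
    and mono: "\<And>s t. s \<le> t \<Longrightarrow> T' t \<le> T' s" and nonneg: "\<And>t. T' t \<ge> 0"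
    and comparable: "\<forall>\<^sub>F u in at_top. T' (2 * u) \<le> T u \<and> T u \<le> T' (u / 2)"
  shows "tail_transfer g rho T' P R"
proof -
  interpret tail_transfer g rho T P R by fact
  show ?thesis
  proof
    fix A :: real assume "A > 0"
    obtain B C where BC: "B > 0" "C > 0" "\<And>\<kappa>. \<kappa> > 0 \<Longrightarrow> \<forall>\<^sub>F n in sequentially.
        real n * T (C * sqrt (real n / G n)) \<le> exp (- (\<kappa> * G n)) \<longrightarrow>
        P n \<le> B * (exp (- (\<kappa> * G n)) + exp (1 - (2 - exp A) * R * G n))"
      using upper[OF \<open>A > 0\<close>] by blast
    have "\<forall>\<^sub>F n in sequentially.
        real n * T' (C / 2 * sqrt (real n / G n)) \<le> exp (- (\<kappa> * G n)) \<longrightarrow>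
        P n \<le> B * (exp (- (\<kappa> * G n)) + exp (1 - (2 - exp A) * R * G n))" if "\<kappa> > 0" for \<kappa>
      using BC(3)[OF that] eventually_compose_filterlim[OF comparable scale_down(2)[OF BC(2)]]
    proof eventually_elim
      case (elim n)
      then have "real n * T (C * sqrt (real n / G n)) \<le> real n * T' (C / 2 * sqrt (real n / G n))"
        by (intro mult_left_mono) auto
      with elim(1) show ?case by (meson order_trans)
    qed
    then show "\<exists>B>0. \<exists>C>0. \<forall>\<kappa>>0. \<forall>\<^sub>F n in sequentially.
        real n * T' (C * sqrt (real n / G n)) \<le> exp (- (\<kappa> * G n)) \<longrightarrow>
        P n \<le> B * (exp (- (\<kappa> * G n)) + exp (1 - (2 - exp A) * R * G n))"
      using BC by (intro exI[of _ B] exI[of _ "C / 2"] conjI) auto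
  next
    obtain C b where C: "C > 0" "b > 0" "\<forall>\<^sub>F n in sequentially.
        P n \<ge> b * (real n * T (C * sqrt (real n * G n)))"
      using lower by blast
    have "\<forall>\<^sub>F n in sequentially. P n \<ge> b * (real n * T' (2 * C * sqrt (real n * G n)))"
      using C(3) eventually_compose_filterlim[OF comparable scale_up(2)[OF C(1)]]
    proof eventually_elim
      case (elim n)
      then have "b * (real n * T' (2 * C * sqrt (real n * G n))) \<le> b * (real n * T (C * sqrt (real n * G n)))"
        using C(2) by (intro mult_left_mono) (auto simp: mult.assoc)
      with elim(1) show ?case by (rule order_trans[rotated])
    qed
    then show "\<exists>C>0. \<exists>b>0. \<forall>\<^sub>F n in sequentially. P n \<ge> b * (real n * T' (C * sqrt (real n * G n)))"
      using C by (intro exI[of _ "2 * C"] exI[of _ b] conjI) auto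
  qed (fact mono nonneg P_nonneg P_le_1 gauss)+
qed

section \<open>Convergence for all x and equality of the tail parameters\<close>

lemma lam_over_le_lam_under: "lam_over g T \<le> lam_under g T"
  unfolding lam_over_def lam_under_def by (simp add: Liminf_le_Limsup)

text \<open>The Gaussian term \<open>x\<^sup>2 / (2v)\<close> is unbounded in \<open>x\<close>, so the truncated rates for all \<open>x\<close>
  determine the untruncated one.\<close>

lemma min_rate_cancel:
  fixes a b :: ereal
  assumes v: "v > 0" and c: "c > 0"
    and eq: "\<And>x. x > 0 \<Longrightarrow> min (ereal (x\<^sup>2 / (2 * v))) (a / ereal c) = min (ereal (x\<^sup>2 / (2 * v))) (b / ereal c)"
  shows "a = b"
proof -
  have aux: "\<not> p < q" if "\<And>x. x > 0 \<Longrightarrow>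
      min (ereal (x\<^sup>2 / (2 * v))) (p / ereal c) = min (ereal (x\<^sup>2 / (2 * v))) (q / ereal c)" for p q :: ereal
  proof
    assume "p < q"
    then have "p / ereal c < q / ereal c"
      using c by (cases p; cases q) (auto simp: divide_strict_right_mono)
    then obtain z where z: "p / ereal c < ereal z" "ereal z < q / ereal c"
      using ereal_dense2 by blast
    \<comment> \<open>This sets the Gaussian term to \<open>max z 1\<close>: at least z, so that it
      does not hide the separation of the two quotients at z, and positive, so that x > 0.\<close>
    define x where "x = sqrt (2 * v * max z 1)"
    have x: "x > 0" "x\<^sup>2 / (2 * v) = max z 1" using v by (simp_all add: x_def)
    have "p / ereal c < ereal (max z 1)" using z(1) by (rule less_le_trans) simp
    then have "min (ereal (max z 1)) (p / ereal c) = p / ereal c"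
      by (intro min.absorb2 less_imp_le)
    with that[OF x(1)] have "p / ereal c = min (ereal (max z 1)) (q / ereal c)"
      unfolding x(2) by simp
    moreover have "ereal z \<le> min (ereal (max z 1)) (q / ereal c)" using z by simp
    ultimately have "ereal z \<le> p / ereal c" by (simp only:)
    with z(1) show False by simp
  qed
  have "\<not> a < b" "\<not> b < a" using eq by (intro aux; simp)+
  then show ?thesis by simp
qed

lemma ldev_tendsto_iff:
  assumes v: "v > 0"
    and rate: "\<And>x. x > 0 \<Longrightarrow> tail_transfer g rho T (P x) (x\<^sup>2 / (2 * v))"
  shows "(\<forall>x>0. (ldev g (P x) \<longlonglongrightarrow> - min (ereal (x\<^sup>2 / (2 * v))) (l / ereal (2 powr rho)))) \<longleftrightarrow>
    lam_over g T = l \<and> lam_under g T = l" (is "?lhs \<longleftrightarrow> ?rhs")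
proof -
  have lim_iff: "(ldev g (P x) \<longlonglongrightarrow> - m) \<longleftrightarrow>
      min (ereal (x\<^sup>2 / (2 * v))) (lam_over g T / ereal (2 powr rho)) = m \<and>
      min (ereal (x\<^sup>2 / (2 * v))) (lam_under g T / ereal (2 powr rho)) = m" if "x > 0" for x m
  proof -
    interpret tail_transfer g rho T "P x" "x\<^sup>2 / (2 * v)" using that by (rule rate)
    show ?thesis
      using tendsto_iff_Liminf_eq_Limsup[OF sequentially_bot, of "ldev g (P x)" "- m"]
      unfolding limsup_ldev liminf_ldev ereal_uminus_eq_iff by blast
  qed
  show ?thesis
  proof
    assume L: ?lhs
    have c: "(2::real) powr rho > 0" by simp
    have "lam_over g T = l"
      by (rule min_rate_cancel[OF v c]) (use L lim_iff in auto)
    moreover have "lam_under g T = l"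
      by (rule min_rate_cancel[OF v c]) (use L lim_iff in auto)
    ultimately show ?rhs ..
  next
    assume ?rhs
    then have "lam_over g T = l" "lam_under g T = l" by blast+
    note lim = lim_iff[unfolded this]
    show ?lhs by (intro allI impI) (simp only: lim)
  qed
qed

text \<open>The case l = infinity of the previous equivalence, where the minimum is the Gaussian
  term. An infinite \<open>lam_over\<close> forces an infinite \<open>lam_under\<close>, which is at
  least as large.\<close>

lemma ldev_tendsto_gauss_iff:
  assumes v: "v > 0"
    and rate: "\<And>x. x > 0 \<Longrightarrow> tail_transfer g rho T (P x) (x\<^sup>2 / (2 * v))"
  shows "(\<forall>x>0. (ldev g (P x) \<longlonglongrightarrow> - ereal (x\<^sup>2 / (2 * v)))) \<longleftrightarrow> lam_over g T = \<infinity>"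
proof -
  have "\<infinity> / ereal (2 powr rho) = \<infinity>" by (simp add: divide_ereal_def)
  then have "min (ereal (x\<^sup>2 / (2 * v))) (\<infinity> / ereal (2 powr rho)) = ereal (x\<^sup>2 / (2 * v))" for x
    by simp
  from ldev_tendsto_iff[OF assms, of \<infinity>, unfolded this] show ?thesis
    using lam_over_le_lam_under[of g T] by (cases "lam_over g T = \<infinity>") auto
qed

subsection \<open>Sums of centered independent variables\<close>

text \<open>For negative u the Taylor polynomial alone dominates exp; for u in [0, A] the Lagrange
  remainder is bounded by exp A. The estimate thus covers arbitrarily negative values, and only the
  upper tail of X has to be truncated.\<close>

lemma exp_le_quadratic:
  assumes "u \<le> A" "A \<ge> 0"
  shows "exp u \<le> 1 + u + u\<^sup>2 / 2 * exp (A :: real)"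
proof (cases "u \<ge> 0")
  case True
  obtain t where t: "\<bar>t\<bar> \<le> \<bar>u\<bar>" "exp u = (\<Sum>m<2. u ^ m / fact m) + exp t / fact 2 * u ^ 2"
    using Maclaurin_exp_le[of u 2] by blast
  have "exp u = 1 + u + exp t / 2 * u\<^sup>2"
    using t(2) by (simp add: numeral_2_eq_2)
  also have "\<dots> \<le> 1 + u + exp A / 2 * u\<^sup>2"
    using t(1) True assms by (intro add_left_mono mult_right_mono divide_right_mono) auto
  finally show ?thesis by (simp add: mult.commute)
next
  case False
  let ?f = "\<lambda>u::real. 1 + u + u\<^sup>2 / 2 - exp u"
  have "?f 0 \<le> ?f u"
  proof (rule DERIV_nonpos_imp_nonincreasing[of u 0 ?f])
    fix x :: real
    have "(?f has_real_derivative 1 + x - exp x) (at x)"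
      by (auto intro!: derivative_eq_intros)
    moreover have "1 + x - exp x \<le> 0"
      using exp_ge_add_one_self[of x] by simp
    ultimately show "\<exists>y. (?f has_real_derivative y) (at x) \<and> y \<le> 0" by blast
  qed (use False in auto)
  moreover have "u\<^sup>2 / 2 * 1 \<le> u\<^sup>2 / 2 * exp A"
    using assms by (intro mult_left_mono) auto
  ultimately show ?thesis by simp
qed

text \<open>The interval (z, z + 1] has at least the mass given by the density at its right end. The
  term -2 pays for the factor 1 / sqrt(2 pi), because sqrt(2 pi) < 3 <= exp 2.\<close>

lemma std_normal_tail:
  assumes "z \<ge> 0"
  shows "measure std_normal_distribution {z<..} > exp (- (z + 1)\<^sup>2 / 2 - 2)"
proof -
  interpret N: real_distribution std_normal_distribution
    by (rule real_dist_normal_dist)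
  let ?c = "std_normal_density (z + 1)"
  have sq: "sqrt (2 * pi) < exp 2"
  proof -
    have "sqrt (2 * pi) < sqrt (3\<^sup>2)"
      using pi_less_4 by (intro real_sqrt_less_mono) (simp add: power2_eq_square)
    also have "\<dots> = 1 + 2" by simp
    also have "\<dots> \<le> exp 2" by (rule exp_ge_add_one_self)
    finally show ?thesis .
  qed
  have "exp (- (z + 1)\<^sup>2 / 2 - 2) = exp (- (z + 1)\<^sup>2 / 2) / exp 2"
    by (simp add: exp_diff)
  also have "\<dots> < exp (- (z + 1)\<^sup>2 / 2) / sqrt (2 * pi)"
    using sq by (intro divide_strict_left_mono) auto
  also have "\<dots> = ?c" by (simp add: std_normal_density_def)
  also have "?c \<le> measure std_normal_distribution {z<..z+1}"
  proof -
    have "ennreal ?c = (\<integral>\<^sup>+ x. ennreal ?c * indicator {z<..z+1} x \<partial>lborel)"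
      by (simp add: nn_integral_cmult_indicator)
    also have "\<dots> \<le> (\<integral>\<^sup>+ x. ennreal (std_normal_density x) * indicator {z<..z+1} x \<partial>lborel)"
    proof (intro nn_integral_mono)
      fix x :: real
      show "ennreal ?c * indicator {z<..z+1} x \<le> ennreal (std_normal_density x) * indicator {z<..z+1} x"
      proof (cases "x \<in> {z<..z+1}")
        case True
        then have "x\<^sup>2 \<le> (z + 1)\<^sup>2" using assms by (intro power_mono) auto
        then have "?c \<le> std_normal_density x"
          unfolding std_normal_density_def by (intro mult_left_mono) auto
        then show ?thesis using True by (simp add: ennreal_leI)
      qed simp
    qed
    also have "\<dots> = emeasure std_normal_distribution {z<..z+1}"
      by (subst emeasure_density) auto
    also have "\<dots> = ennreal (measure std_normal_distribution {z<..z+1})"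
      by (rule N.emeasure_eq_measure)
    finally show ?thesis by simp
  qed
  also have "\<dots> \<le> measure std_normal_distribution {z<..}"
    by (intro N.finite_measure_mono) auto
  finally show ?thesis .
qed

section \<open>Independent, identically distributed, centered summands\<close>

locale iid_centered = prob_space M for M :: "'a measure" +
  fixes X :: "nat \<Rightarrow> 'a \<Rightarrow> real" and v :: real
  assumes rv [measurable]: "\<And>i. X i \<in> borel_measurable M"
    and indep: "indep_vars (\<lambda>_. borel) X UNIV"
    and ident: "\<And>i. distr M borel (X i) = distr M borel (X 0)"
    and sq_integrable: "integrable M (\<lambda>\<omega>. (X 0 \<omega>)\<^sup>2)"
    and mean_zero: "expectation (X 0) = 0"
    and second_moment: "expectation (\<lambda>\<omega>. (X 0 \<omega>)\<^sup>2) = v"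
    and v_pos: "v > 0"
begin

lemma
  fixes f :: "real \<Rightarrow> real"
  assumes [measurable]: "f \<in> borel_measurable borel"
  shows integral_ident: "expectation (\<lambda>\<omega>. f (X i \<omega>)) = expectation (\<lambda>\<omega>. f (X 0 \<omega>))"
    and integrable_ident: "integrable M (\<lambda>\<omega>. f (X i \<omega>)) \<longleftrightarrow> integrable M (\<lambda>\<omega>. f (X 0 \<omega>))"
proof -
  show "expectation (\<lambda>\<omega>. f (X i \<omega>)) = expectation (\<lambda>\<omega>. f (X 0 \<omega>))"
    using integral_distr[OF rv assms, of i] integral_distr[OF rv assms, of 0] ident[of i] by simp
  show "integrable M (\<lambda>\<omega>. f (X i \<omega>)) \<longleftrightarrow> integrable M (\<lambda>\<omega>. f (X 0 \<omega>))"
    using integrable_distr_eq[OF rv assms, of i] integrable_distr_eq[OF rv assms, of 0] ident[of i]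
    by simp
qed

lemma prob_ident:
  assumes [measurable]: "B \<in> sets borel"
  shows "prob {\<omega> \<in> space M. X i \<omega> \<in> B} = prob {\<omega> \<in> space M. X 0 \<omega> \<in> B}"
proof -
  have "prob {\<omega> \<in> space M. X i \<omega> \<in> B} = measure (distr M borel (X i)) B" for i
    by (subst measure_distr) (auto simp: vimage_def Int_def conj_commute)
  then show ?thesis using ident by metis
qed

lemma sq_integrable' [simp]: "integrable M (\<lambda>\<omega>. (X i \<omega>)\<^sup>2)"
  using integrable_ident[of "\<lambda>x. x\<^sup>2" i] sq_integrable by simp

lemma integrable_X [simp]: "integrable M (X i)"
  by (rule square_integrable_imp_integrable) simp_all

lemma mean_zero' [simp]: "expectation (X i) = 0"
  using integral_ident[of "\<lambda>x. x" i] mean_zero by simp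

lemma second_moment' [simp]: "expectation (\<lambda>\<omega>. (X i \<omega>)\<^sup>2) = v"
  using integral_ident[of "\<lambda>x. x\<^sup>2" i] second_moment by simp

definition tail :: "real \<Rightarrow> real" where
  "tail u = prob {\<omega> \<in> space M. X 0 \<omega> > u}"

definition sum_tail :: "nat \<Rightarrow> real \<Rightarrow> real" where
  "sum_tail n u = prob {\<omega> \<in> space M. (\<Sum>i\<in>{1..n}. X i \<omega>) > u}"

lemma prob_tail: "prob {\<omega> \<in> space M. X i \<omega> > u} = tail u"
  using prob_ident[of "{u<..}" i] by (simp add: tail_def)

lemma tail_mono: "u \<le> w \<Longrightarrow> tail w \<le> tail u"
  unfolding tail_def by (intro finite_measure_mono) auto

lemma sum_tail_mono: "u \<le> w \<Longrightarrow> sum_tail n w \<le> sum_tail n u"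
  unfolding sum_tail_def by (intro finite_measure_mono) auto

text \<open>Adding one independent term convolves with the common law, so the law of a sum depends
  only on the number of terms. This lets \<open>sum_tail n\<close> stand for any block of n
  indices.\<close>

lemma distr_sum:
  assumes "finite I" "finite J" "card I = card J"
  shows "distr M borel (\<lambda>\<omega>. \<Sum>i\<in>I. X i \<omega>) = distr M borel (\<lambda>\<omega>. \<Sum>i\<in>J. X i \<omega>)"
  using assms
proof (induction I arbitrary: J rule: finite_induct)
  case empty
  then show ?case by simp
next
  case (insert i I)
  then obtain j J' where J: "J = insert j J'" "j \<notin> J'" "finite J'" "card J' = card I"
    by (metis card_Suc_eq_finite card_insert_disjoint)
  have conv: "distr M borel (\<lambda>\<omega>. \<Sum>i\<in>insert k K. X i \<omega>) =
      convolution (distr M borel (X 0)) (distr M borel (\<lambda>\<omega>. \<Sum>i\<in>K. X i \<omega>))"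
    if "finite K" "k \<notin> K" for k K
  proof -
    have "indep_var borel (X k) borel (\<lambda>\<omega>. \<Sum>i\<in>K. X i \<omega>)"
      using that by (intro indep_vars_sum indep_vars_subset[OF indep]) auto
    from sum_indep_random_variable[OF this] show ?thesis
      using that ident[of k] by simp
  qed
  have "distr M borel (\<lambda>\<omega>. \<Sum>i\<in>I. X i \<omega>) = distr M borel (\<lambda>\<omega>. \<Sum>i\<in>J'. X i \<omega>)"
    by (rule insert.IH) (simp_all add: J)
  then show ?case
    unfolding J(1) conv[OF insert.hyps(1,2)] conv[OF J(3,2)] by simp
qed

lemma prob_sum_card:
  assumes "finite I" "card I = n"
  shows "prob {\<omega> \<in> space M. (\<Sum>i\<in>I. X i \<omega>) > u} = sum_tail n u"
proof -
  have "prob {\<omega> \<in> space M. (\<Sum>i\<in>J. X i \<omega>) > u} =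
      measure (distr M borel (\<lambda>\<omega>. \<Sum>i\<in>J. X i \<omega>)) {u<..}" for J
    by (subst measure_distr) (auto simp: vimage_def Int_def conj_commute)
  then show ?thesis
    using distr_sum[of I "{1..n}"] assms unfolding sum_tail_def by simp
qed

lemma prob_indep_sum:
  assumes "finite I" "finite J" "I \<inter> J = {}"
  shows "prob {\<omega> \<in> space M. (\<Sum>i\<in>I. X i \<omega>) > u \<and> (\<Sum>i\<in>J. X i \<omega>) > w} =
    sum_tail (card I) u * sum_tail (card J) w"
proof -
  have "indep_var (PiM I (\<lambda>_. borel)) (\<lambda>\<omega>. restrict (\<lambda>i. X i \<omega>) I)
      (PiM J (\<lambda>_. borel)) (\<lambda>\<omega>. restrict (\<lambda>i. X i \<omega>) J)"
    using assms by (intro indep_var_restrict[OF indep]) auto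
  then have "indep_var borel ((\<lambda>f. \<Sum>i\<in>I. f i :: real) \<circ> (\<lambda>\<omega>. restrict (\<lambda>i. X i \<omega>) I))
      borel ((\<lambda>f. \<Sum>i\<in>J. f i :: real) \<circ> (\<lambda>\<omega>. restrict (\<lambda>i. X i \<omega>) J))"
    by (rule indep_var_compose) auto
  then have "indep_var borel (\<lambda>\<omega>. \<Sum>i\<in>I. X i \<omega>) borel (\<lambda>\<omega>. \<Sum>i\<in>J. X i \<omega>)"
    by (simp add: comp_def)
  from indep_varD[OF this, of "{u<..}" "{w<..}"]
  have "prob {\<omega> \<in> space M. (\<Sum>i\<in>I. X i \<omega>) > u \<and> (\<Sum>i\<in>J. X i \<omega>) > w} =
     prob {\<omega> \<in> space M. (\<Sum>i\<in>I. X i \<omega>) > u} * prob {\<omega> \<in> space M. (\<Sum>i\<in>J. X i \<omega>) > w}"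
    by (simp add: vimage_def Int_def conj_commute)
  then show ?thesis
    using assms by (simp add: prob_sum_card)
qed

text \<open>Consecutive blocks are independent, and if each exceeds its own level then the total
  exceeds the sum of the levels.\<close>

lemma sum_tail_add:
  "sum_tail a u * sum_tail b w \<le> sum_tail (a + b) (u + w)"
proof -
  have "{a+1..a+b} \<inter> {1..a} = {}" by auto
  then have "sum_tail a u * sum_tail b w =
      prob {\<omega> \<in> space M. (\<Sum>i\<in>{1..a}. X i \<omega>) > u \<and> (\<Sum>i\<in>{a+1..a+b}. X i \<omega>) > w}"
    by (subst prob_indep_sum) auto
  also have "\<dots> \<le> sum_tail (a + b) (u + w)"
    unfolding sum_tail_def
  proof (intro finite_measure_mono)
    have "{1..a+b} = {1..a} \<union> {a+1..a+b}" by auto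
    then have "(\<Sum>i\<in>{1..a+b}. X i \<omega>) = (\<Sum>i\<in>{1..a}. X i \<omega>) + (\<Sum>i\<in>{a+1..a+b}. X i \<omega>)" for \<omega>
      by (simp add: sum.union_disjoint)
    then show "{\<omega> \<in> space M. (\<Sum>i\<in>{1..a}. X i \<omega>) > u \<and> (\<Sum>i\<in>{a+1..a+b}. X i \<omega>) > w}
      \<subseteq> {\<omega> \<in> space M. (\<Sum>i\<in>{1..a+b}. X i \<omega>) > u + w}" by auto
  qed auto
  finally show ?thesis .
qed

text \<open>The case k = 0 is false: the empty product is 1, whereas an empty sum never exceeds
  0.\<close>

lemma sum_tail_power:
  assumes "k \<ge> 1"
  shows "sum_tail m u ^ k \<le> sum_tail (k * m) (real k * u)"
  using assms
proof (induction k rule: nat_induct_at_least)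
  case base
  then show ?case by simp
next
  case (Suc k)
  have "sum_tail m u ^ Suc k \<le> sum_tail m u * sum_tail (k * m) (real k * u)"
    using Suc.IH by (simp add: mult_left_mono sum_tail_def)
  also have "\<dots> \<le> sum_tail (Suc k * m) (real (Suc k) * u)"
    using sum_tail_add[of m u "k * m" "real k * u"] by (simp add: algebra_simps)
  finally show ?case .
qed

lemma variance_sum:
  assumes "finite I"
  shows "integrable M (\<lambda>\<omega>. (\<Sum>i\<in>I. X i \<omega>)\<^sup>2)"
    and "expectation (\<lambda>\<omega>. (\<Sum>i\<in>I. X i \<omega>)\<^sup>2) = real (card I) * v"
  using assms
proof (induction I rule: finite_induct)
  case (insert i I)
  let ?S = "\<lambda>\<omega>. \<Sum>j\<in>I. X j \<omega>"
  have ind: "indep_var borel (X i) borel ?S"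
    using insert by (intro indep_vars_sum indep_vars_subset[OF indep]) auto
  have int: "integrable M ?S" by simp
  note P = indep_var_integrable[OF ind integrable_X int]
  have E: "expectation (\<lambda>\<omega>. X i \<omega> * ?S \<omega>) = 0"
    by (simp add: indep_var_lebesgue_integral[OF ind integrable_X int])
  have eq: "(\<lambda>\<omega>. (\<Sum>j\<in>insert i I. X j \<omega>)\<^sup>2) = (\<lambda>\<omega>. (X i \<omega>)\<^sup>2 + 2 * (X i \<omega> * ?S \<omega>) + (?S \<omega>)\<^sup>2)"
    using insert by (auto simp: power2_eq_square algebra_simps)
  {
    case 1
    show ?case unfolding eq using insert P by simp
  next
    case 2
    show ?case unfolding eq using insert P E by (simp add: algebra_simps)
  }
qed simp_all

text \<open>Chebyshev's inequality. It keeps the remaining terms from cancelling a big jump, and the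
  leftover indices from cancelling the Gaussian blocks.\<close>

lemma sum_tail_neg:
  assumes "b > 0"
  shows "sum_tail n (- b) \<ge> 1 - real n * v / b\<^sup>2"
proof -
  let ?S = "\<lambda>\<omega>. \<Sum>i\<in>{1..n}. X i \<omega>"
  have E: "expectation ?S = 0" by simp
  have "prob {\<omega> \<in> space M. \<bar>?S \<omega> - expectation ?S\<bar> \<ge> b} \<le> variance ?S / b\<^sup>2"
    using assms variance_sum[of "{1..n}"] by (intro Chebyshev_inequality) auto
  then have 1: "prob {\<omega> \<in> space M. \<bar>?S \<omega>\<bar> \<ge> b} \<le> real n * v / b\<^sup>2"
    unfolding E using variance_sum[of "{1..n}"] by simp
  have "{\<omega> \<in> space M. ?S \<omega> > - b} = space M - {\<omega> \<in> space M. ?S \<omega> \<le> - b}" by auto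
  then have "sum_tail n (-b) = 1 - prob {\<omega> \<in> space M. ?S \<omega> \<le> - b}"
    unfolding sum_tail_def by (simp add: prob_compl)
  moreover have "prob {\<omega> \<in> space M. ?S \<omega> \<le> - b} \<le> prob {\<omega> \<in> space M. \<bar>?S \<omega>\<bar> \<ge> b}"
    by (intro finite_measure_mono) auto
  ultimately show ?thesis using 1 by simp
qed

lemma tail_bound:
  assumes "u > 0"
  shows "tail u \<le> v / u\<^sup>2"
proof -
  have "prob {\<omega> \<in> space M. \<bar>X 0 \<omega> - expectation (X 0)\<bar> \<ge> u} \<le> variance (X 0) / u\<^sup>2"
    using assms by (intro Chebyshev_inequality) auto
  moreover have "tail u \<le> prob {\<omega> \<in> space M. \<bar>X 0 \<omega>\<bar> \<ge> u}"
    unfolding tail_def by (intro finite_measure_mono) auto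
  ultimately show ?thesis by simp
qed

text \<open>One big jump: the events \<open>X i > \<tau> + b\<close> are made disjoint by removing all other jumps, which
  needs only pairwise independence and costs a factor \<open>1 - n P(X > \<tau> + b)\<close>.\<close>

lemma sum_tail_ge_jump:
  assumes n: "n \<ge> 1" and small: "real n * tail (\<tau> + b) \<le> 1/4"
    and b: "b > 0" "b\<^sup>2 \<ge> 4 * v * real n"
  shows "sum_tail n \<tau> \<ge> real n / 2 * tail (\<tau> + b)"
proof -
  define p where "p = tail (\<tau> + b)"
  have p: "p \<ge> 0" by (simp add: p_def tail_def)
  let ?I = "{1..n}"
  \<comment> \<open>The second condition keeps the other terms together above -b, so that the whole
    sum exceeds \<tau> on \<open>E i\<close>.\<close>
  define E where "E i = {\<omega> \<in> space M. X i \<omega> > \<tau> + b \<and> (\<Sum>j\<in>?I - {i}. X j \<omega>) > - b}" for i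
  define F where "F i j = {\<omega> \<in> space M. X i \<omega> > \<tau> + b \<and> X j \<omega> > \<tau> + b}" for i j
  define D where "D i = E i - (\<Union>j\<in>?I - {i}. F i j)" for i
  have [measurable]: "E i \<in> sets M" "F i j \<in> sets M" "D i \<in> sets M" for i j
    unfolding E_def F_def D_def by measurable
  \<comment> \<open>Indices start at 1 in \<open>sum_tail\<close> but \<open>tail\<close> refers to
    \<open>X 0\<close>, hence the detour through a singleton block.\<close>
  have t1: "sum_tail (Suc 0) u = tail u" for u
    using prob_sum_card[of "{0}" 1 u] by (simp add: tail_def)
  have probE: "prob (E i) \<ge> p * (3/4)" if "i \<in> ?I" for i
  proof -
    have "prob (E i) = tail (\<tau> + b) * sum_tail (n - 1) (- b)"
      unfolding E_def using prob_indep_sum[of "{i}" "?I - {i}" "\<tau> + b" "- b"] that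
      by (simp add: t1)
    moreover have "real (n - 1) * v / b\<^sup>2 \<le> 1/4"
    proof -
      have "real (n - 1) * v \<le> real n * v"
        using v_pos by (intro mult_right_mono) auto
      then have "real (n - 1) * v * 4 \<le> b\<^sup>2" using b by (simp add: mult_ac)
      then show ?thesis using b by (simp add: divide_simps)
    qed
    moreover from this sum_tail_neg[OF b(1), of "n - 1"] have "3/4 \<le> sum_tail (n - 1) (- b)"
      by linarith
    ultimately show ?thesis
      using p unfolding p_def by (simp only: mult_left_mono)
  qed
  have probF: "prob (F i j) = p * p" if "i \<noteq> j" for i j
    unfolding F_def using prob_indep_sum[of "{i}" "{j}" "\<tau> + b" "\<tau> + b"] that
    by (simp add: t1 p_def)
  \<comment> \<open>The condition on b leaves 3/4 of p for \<open>E i\<close>; removing the double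
    jumps costs at most n p^2 <= p / 4.\<close>
  have probD: "prob (D i) \<ge> p / 2" if i: "i \<in> ?I" for i
  proof -
    have "prob (\<Union>j\<in>?I - {i}. F i j) \<le> (\<Sum>j\<in>?I - {i}. prob (F i j))"
      by (intro finite_measure_subadditive_finite) auto
    also have "\<dots> = real (n - 1) * (p * p)"
      using i by (subst sum.cong[OF refl, of _ _ "\<lambda>_. p * p"]) (auto simp: probF)
    also have "\<dots> \<le> real n * p * p"
      using p by (simp only: mult.assoc) (intro mult_right_mono, auto)
    also have "\<dots> \<le> 1/4 * p"
      using small p unfolding p_def by (intro mult_right_mono) auto
    finally have "prob (\<Union>j\<in>?I - {i}. F i j) \<le> 1/4 * p" .
    moreover have "prob (E i) \<le> prob (D i) + prob (\<Union>j\<in>?I - {i}. F i j)"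
    proof -
      have "prob (E i) \<le> prob (D i \<union> (\<Union>j\<in>?I - {i}. F i j))"
        by (intro finite_measure_mono) (auto simp: D_def)
      also have "\<dots> \<le> prob (D i) + prob (\<Union>j\<in>?I - {i}. F i j)"
        by (intro measure_Un_le) auto
      finally show ?thesis .
    qed
    ultimately show ?thesis using probE[OF i] by simp
  qed
  have disj: "disjoint_family_on D ?I"
    unfolding disjoint_family_on_def D_def E_def F_def by auto
  have "real n * (p / 2) = (\<Sum>i\<in>?I. p / 2)" by simp
  also have "\<dots> \<le> (\<Sum>i\<in>?I. prob (D i))"
    by (intro sum_mono probD)
  also have "\<dots> = prob (\<Union>i\<in>?I. D i)"
    using disj by (subst finite_measure_finite_Union) auto
  also have "\<dots> \<le> sum_tail n \<tau>"
    unfolding sum_tail_def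
  proof (intro finite_measure_mono)
    have "\<tau> < (\<Sum>j\<in>?I. X j \<omega>)" if "i \<in> ?I" "\<omega> \<in> E i" for i \<omega>
      using that sum.remove[of ?I i "\<lambda>j. X j \<omega>"] by (auto simp: E_def)
    then show "(\<Union>i\<in>?I. D i) \<subseteq> {\<omega> \<in> space M. \<tau> < (\<Sum>i\<in>?I. X i \<omega>)}"
      by (fastforce simp: D_def E_def)
  qed auto
  finally show ?thesis by (simp add: p_def)
qed

text \<open>Chernoff bound after truncation at the level \<open>y\<close>: the exponential moment of the truncated
  variable is split at \<open>A / h\<close>.\<close>

lemma sum_tail_le_truncated:
  assumes h: "h > 0" and A: "A > 0" and y: "y \<ge> A / h"
  shows "sum_tail n \<tau> \<le> real n * tail (A / h) +
    exp (- (h * \<tau>) + real n * (h\<^sup>2 / 2 * exp A * v + exp (h * y) * tail (A / h)))"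
proof -
  let ?I = "{1..n}"
  \<comment> \<open>Values above y are sent to 0. If no \<open>X i\<close> exceeds y, the product of
    the \<open>Z i\<close> is still the exponential of h times the sum; the exceptional event is
    handled by a union bound.\<close>
  define Z where "Z i \<omega> = exp (h * X i \<omega>) * indicator {..y} (X i \<omega>)" for i \<omega>
  define B where "B = h\<^sup>2 / 2 * exp A * v + exp (h * y) * tail (A / h)"
  have Z_nonneg: "Z i \<omega> \<ge> 0" for i \<omega> by (simp add: Z_def)
  have [measurable]: "Z i \<in> borel_measurable M" for i unfolding Z_def by measurable
  have int_Z [simp]: "integrable M (Z i)" for i
  proof (rule integrable_const_bound[of _ "exp (h * y)"])
    show "AE \<omega> in M. norm (Z i \<omega>) \<le> exp (h * y)"
      using h by (auto simp: Z_def indicator_def)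
  qed measurable
  have EZ: "expectation (Z i) \<le> exp B" for i
  proof -
    let ?J = "{\<omega> \<in> space M. X i \<omega> > A / h}"
    have int_J: "integrable M (\<lambda>\<omega>. exp (h * y) * indicator ?J \<omega>)"
      by (intro integrable_mult_right integrable_real_indicator) (auto simp: emeasure_eq_measure)
    \<comment> \<open>Below A / h the quadratic bound applies; on \<open>?J\<close> the crude bound
      exp (h y) is charged instead. The linear term disappears in the expectation because X is
      centered.\<close>
    have "expectation (Z i) \<le> expectation (\<lambda>\<omega>. 1 + h * X i \<omega> + h\<^sup>2 / 2 * exp A * (X i \<omega>)\<^sup>2
        + exp (h * y) * indicator ?J \<omega>)"
    proof (intro integral_mono)
      fix \<omega> assume \<omega>: "\<omega> \<in> space M"
      show "Z i \<omega> \<le> 1 + h * X i \<omega> + h\<^sup>2 / 2 * exp A * (X i \<omega>)\<^sup>2 + exp (h * y) * indicator ?J \<omega>"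
      proof (cases "X i \<omega> > A / h")
        case True
        then have "h * X i \<omega> \<ge> 0" using A h
          by (metis divide_pos_pos less_eq_real_def mult_nonneg_nonneg order_less_trans)
        moreover have "Z i \<omega> \<le> exp (h * y)"
          using h by (auto simp: Z_def indicator_def)
        moreover have "h\<^sup>2 / 2 * exp A * (X i \<omega>)\<^sup>2 \<ge> 0" by simp
        ultimately have "Z i \<omega> \<le> 1 + h * X i \<omega> + h\<^sup>2 / 2 * exp A * (X i \<omega>)\<^sup>2 + exp (h * y) * 1"
          by linarith
        then show ?thesis using True \<omega> by simp
      next
        case False
        then have "h * X i \<omega> \<le> A" using h by (simp add: field_simps)
        from exp_le_quadratic[OF this] A
        have "exp (h * X i \<omega>) \<le> 1 + h * X i \<omega> + h\<^sup>2 / 2 * exp A * (X i \<omega>)\<^sup>2"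
          by (simp add: power_mult_distrib mult_ac)
        moreover have "Z i \<omega> \<le> exp (h * X i \<omega>)" by (simp add: Z_def indicator_def)
        ultimately show ?thesis using False by simp
      qed
    qed (auto intro: int_J)
    also have "\<dots> = 1 + B"
      using int_J by (simp add: prob_space prob_tail B_def)
    also have "\<dots> \<le> exp B" by (rule exp_ge_add_one_self)
    finally show ?thesis .
  qed
  have "indep_vars (\<lambda>_. borel) Z ?I"
    unfolding Z_def by (intro indep_vars_compose2[OF indep_vars_subset[OF indep]]) auto
  note Zprod = indep_vars_integrable[OF _ this int_Z] indep_vars_lebesgue_integral[OF _ this int_Z]
  have "expectation (\<lambda>\<omega>. \<Prod>i\<in>?I. Z i \<omega>) = (\<Prod>i\<in>?I. expectation (Z i))"
    by (rule Zprod) auto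
  also have "\<dots> \<le> (\<Prod>i\<in>?I. exp B)"
    by (intro prod_mono) (auto intro!: EZ Bochner_Integration.integral_nonneg Z_nonneg)
  finally have E_prod: "expectation (\<lambda>\<omega>. \<Prod>i\<in>?I. Z i \<omega>) \<le> exp (real n * B)"
    by (simp add: exp_of_nat_mult)
  define C where "C = {\<omega> \<in> space M. (\<Prod>i\<in>?I. Z i \<omega>) \<ge> exp (h * \<tau>)}"
  define D where "D = (\<Union>i\<in>?I. {\<omega> \<in> space M. X i \<omega> > y})"
  have [measurable]: "C \<in> sets M" "D \<in> sets M" unfolding C_def D_def by measurable
  have "prob C \<le> expectation (\<lambda>\<omega>. \<Prod>i\<in>?I. Z i \<omega>) / exp (h * \<tau>)"
    unfolding C_def using Zprod(1) Z_nonneg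
    by (intro integral_Markov_inequality_measure[where A = "{}"]) (auto intro!: prod_nonneg)
  also have "\<dots> \<le> exp (real n * B) / exp (h * \<tau>)"
    using E_prod by (intro divide_right_mono) auto
  also have "\<dots> = exp (- (h * \<tau>) + real n * B)"
    by (simp add: exp_diff[symmetric] exp_add exp_minus field_simps)
  finally have C: "prob C \<le> exp (- (h * \<tau>) + real n * B)" .
  have "prob D \<le> (\<Sum>i\<in>?I. prob {\<omega> \<in> space M. X i \<omega> > y})"
    unfolding D_def by (intro finite_measure_subadditive_finite) auto
  also have "\<dots> = real n * tail y" by (simp add: prob_tail)
  also have "\<dots> \<le> real n * tail (A / h)"
    using y by (intro mult_left_mono tail_mono) auto
  finally have D: "prob D \<le> real n * tail (A / h)" .
  have "sum_tail n \<tau> \<le> prob (D \<union> C)"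
    unfolding sum_tail_def
  proof (intro finite_measure_mono subsetI)
    fix \<omega> assume "\<omega> \<in> {\<omega> \<in> space M. \<tau> < (\<Sum>i\<in>?I. X i \<omega>)}"
    then have \<omega>: "\<omega> \<in> space M" "\<tau> < (\<Sum>i\<in>?I. X i \<omega>)" by auto
    show "\<omega> \<in> D \<union> C"
    proof (cases "\<omega> \<in> D")
      case False
      then have "(\<Prod>i\<in>?I. Z i \<omega>) = (\<Prod>i\<in>?I. exp (h * X i \<omega>))"
        using \<omega> by (intro prod.cong) (auto simp: D_def Z_def not_less)
      also have "\<dots> = exp (h * (\<Sum>i\<in>?I. X i \<omega>))"
        by (simp add: exp_sum sum_distrib_left)
      also have "\<dots> \<ge> exp (h * \<tau>)" using \<omega> h by simp
      finally show ?thesis using \<omega> by (simp add: C_def)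
    qed simp
  qed measurable
  also have "\<dots> \<le> prob D + prob C" by (intro measure_Un_le) auto
  finally show ?thesis using C D unfolding B_def by linarith
qed

text \<open>The chosen h minimises - h \<tau> + n h^2 v / 2 at \<tau> = x sqrt(n G). The truncation
  level y satisfies exp (h y) = exp (\<kappa> G), which exactly offsets the assumed bound on the
  tail and leaves the additive 1 in the exponent; \<kappa> G >= A amounts to y >= A / h.\<close>

lemma sum_tail_upper:
  assumes "x > 0" "G > 0" "n \<ge> 1" "A > 0" "\<kappa> > 0" "\<kappa> * G \<ge> A"
    and small: "real n * tail (A * v / x * sqrt (real n / G)) \<le> exp (- (\<kappa> * G))"
  shows "sum_tail n (x * sqrt (real n * G)) \<le>
    exp (- (\<kappa> * G)) + exp (1 - (2 - exp A) * (x\<^sup>2 / (2 * v)) * G)"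
proof -
  define h where "h = x * sqrt (G / real n) / v"
  define y where "y = \<kappa> * G / h"
  have h: "h > 0" using assms v_pos by (simp add: h_def)
  have u: "A / h = A * v / x * sqrt (real n / G)"
    using assms v_pos by (simp add: h_def real_sqrt_divide)
  have "h * (x * sqrt (real n * G)) = x\<^sup>2 / v * G"
    using assms v_pos by (simp add: h_def real_sqrt_divide real_sqrt_mult power2_eq_square field_simps)
  moreover have "real n * (h\<^sup>2 / 2 * exp A * v) = exp A * (x\<^sup>2 / (2 * v)) * G"
    using assms v_pos by (simp add: h_def power_mult_distrib power_divide power2_eq_square[of v] field_simps)
  moreover have "real n * (exp (h * y) * tail (A / h)) \<le> 1"
  proof -
    have "real n * (exp (h * y) * tail (A / h)) = exp (\<kappa> * G) * (real n * tail (A / h))"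
      using h by (simp add: y_def)
    also have "\<dots> \<le> exp (\<kappa> * G) * exp (- (\<kappa> * G))"
      using small unfolding u by (intro mult_left_mono) auto
    finally show ?thesis by (simp add: exp_minus)
  qed
  ultimately have "- (h * (x * sqrt (real n * G))) + real n * (h\<^sup>2 / 2 * exp A * v + exp (h * y) * tail (A / h))
      \<le> 1 - (2 - exp A) * (x\<^sup>2 / (2 * v)) * G"
    using v_pos by (simp add: ring_distribs diff_divide_distrib)
  moreover have "y \<ge> A / h" unfolding y_def using assms h by (intro divide_right_mono) auto
  moreover have "real n * tail (A / h) \<le> exp (- (\<kappa> * G))" using small unfolding u .
  ultimately show ?thesis
    using sum_tail_le_truncated[OF h \<open>A > 0\<close>, of y n "x * sqrt (real n * G)"]
    by (meson add_mono exp_le_cancel_iff order_trans)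
qed

text \<open>The allowance b for the other terms is taken equal to the target, so the jump has to
  reach twice the target. Chebyshev's inequality and x^2 G >= 4 v then provide the smallness
  required for the one-jump bound.\<close>

lemma sum_tail_lower_jump:
  assumes x: "x > 0" and G: "G > 0" "x\<^sup>2 * G \<ge> 4 * v" and n: "n \<ge> 1"
  shows "sum_tail n (x * sqrt (real n * G)) \<ge> real n / 2 * tail (2 * x * sqrt (real n * G))"
proof -
  define b where "b = x * sqrt (real n * G)"
  have b: "b > 0" "b\<^sup>2 = x\<^sup>2 * G * real n"
    using assms by (auto simp: b_def power_mult_distrib)
  have "tail (b + b) \<le> v / (b + b)\<^sup>2" using b by (intro tail_bound) auto
  also have "\<dots> \<le> v / b\<^sup>2"
    using b(1) v_pos by (intro divide_left_mono power_mono mult_pos_pos) auto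
  also have "\<dots> \<le> v / (4 * v * real n)"
  proof (rule divide_left_mono)
    show "4 * v * real n \<le> b\<^sup>2" unfolding b(2) using G n by (intro mult_right_mono) auto
  qed (use b(1) v_pos n in auto)
  finally have "real n * tail (b + b) \<le> 1/4"
    using n v_pos by (simp add: field_simps)
  then show ?thesis
    using sum_tail_ge_jump[of n b b] b n mult_right_mono[OF G(2), of "real n"]
    by (simp add: b_def mult_ac)
qed

lemma sum_tail_clt:
  assumes z: "z \<ge> 0"
  shows "\<forall>\<^sub>F m in sequentially. sum_tail m (z * sqrt (real m * v)) \<ge> exp (- (z + 1)\<^sup>2 / 2 - 2)"
proof -
  interpret N: real_distribution std_normal_distribution
    by (rule real_dist_normal_dist)
  let ?D = "\<lambda>n. distr M borel (\<lambda>\<omega>. (\<Sum>i<n. X i \<omega>) / sqrt (real n * (sqrt v)\<^sup>2))"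
  have "weak_conv_m ?D std_normal_distribution"
    using v_pos ident by (intro central_limit_theorem_zero_mean[OF indep]) auto
  moreover have "isCont (cdf std_normal_distribution) z"
    by (subst N.isCont_cdf) (simp add: measure_def emeasure_density nn_integral_indicator_singleton)
  ultimately have "(\<lambda>n. cdf (?D n) z) \<longlonglongrightarrow> cdf std_normal_distribution z"
    unfolding weak_conv_m_def weak_conv_def by blast
  then have lim: "(\<lambda>n. 1 - cdf (?D n) z) \<longlonglongrightarrow> 1 - cdf std_normal_distribution z"
    by (intro tendsto_intros)
  have "{z<..} = space std_normal_distribution - {..z}" by auto
  then have "measure std_normal_distribution {z<..} = 1 - cdf std_normal_distribution z"
    unfolding cdf_def by (simp only:) (subst N.prob_compl, auto)
  with std_normal_tail[OF z] have "1 - cdf std_normal_distribution z > exp (- (z + 1)\<^sup>2 / 2 - 2)"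
    by simp
  from order_tendstoD(1)[OF lim this] show ?thesis
    using eventually_gt_at_top[of 0]
  proof eventually_elim
    case (elim m)
    have "cdf (?D m) z = prob {\<omega> \<in> space M. (\<Sum>i<m. X i \<omega>) \<le> z * sqrt (real m * v)}"
      unfolding cdf_def using elim v_pos
      by (subst measure_distr) (auto intro!: arg_cong[where f = prob] simp: field_simps)
    also have "\<dots> = prob (space M - {\<omega> \<in> space M. (\<Sum>i<m. X i \<omega>) > z * sqrt (real m * v)})"
      by (intro arg_cong[where f = prob]) auto
    also have "\<dots> = 1 - sum_tail m (z * sqrt (real m * v))"
      using prob_sum_card[of "{..<m}" m "z * sqrt (real m * v)"] by (subst prob_compl) auto
    finally show ?case using elim by simp
  qed
qed

text \<open>Put t = sqrt(n G(n)). Each of k blocks of length m exceeds x1 t / k, and the n mod k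
  leftover terms stay above -(x1 - x) t. The slack x < x1 pays for the leftover terms, x1 < x2 for
  rounding the block length, and x2 < sqrt(2 v R) for the losses in the normal
  approximation.\<close>

lemma sum_tail_lower_gauss:
  assumes x: "x > 0" and G: "filterlim G at_top sequentially"
    and Gn: "(\<lambda>n. G n / real n) \<longlonglongrightarrow> 0" and R: "R > x\<^sup>2 / (2 * v)"
  shows "\<forall>\<^sub>F n in sequentially. sum_tail n (x * sqrt (real n * G n)) \<ge> exp (- (R * G n))"
proof -
  have "x < sqrt (2 * v * R)"
    using R v_pos by (intro real_less_rsqrt) (simp add: field_simps)
  then obtain x1 where x1: "x < x1" "x1 < sqrt (2 * v * R)" using dense by blast
  then obtain x2 where x2: "x1 < x2" "x2 < sqrt (2 * v * R)" using dense by blast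
  have "x2\<^sup>2 < (sqrt (2 * v * R))\<^sup>2"
    using x2 x1 x by (intro power_strict_mono) auto
  moreover have "sqrt (2 * v * R) > 0" using x2 x1 x by linarith
  ultimately have "x2\<^sup>2 < 2 * v * R" by simp
  then have "x2\<^sup>2 / (2 * v) < R" using v_pos by (simp add: field_simps)
  \<comment> \<open>The expression is a / L^2 for the a defined below: about G(n) / L^2 blocks at a
    cost of exp (- a) each. The additive losses 1 and 2 inside a vanish as L grows.\<close>
  moreover have "((\<lambda>L. (x2 / sqrt v + inverse L)\<^sup>2 / 2 + 2 * (inverse L)\<^sup>2) \<longlongrightarrow>
      (x2 / sqrt v + 0)\<^sup>2 / 2 + 2 * 0\<^sup>2) at_top"
    by (intro tendsto_intros tendsto_inverse_0_at_top filterlim_ident) auto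
  then have "((\<lambda>L. (x2 / sqrt v + inverse L)\<^sup>2 / 2 + 2 * (inverse L)\<^sup>2) \<longlongrightarrow> x2\<^sup>2 / (2 * v)) at_top"
    using v_pos by (simp add: power_divide mult.commute)
  ultimately have "\<forall>\<^sub>F L in at_top. (x2 / sqrt v + inverse L)\<^sup>2 / 2 + 2 * (inverse L)\<^sup>2 < R"
    by (intro order_tendstoD(2)) auto
  then have "\<forall>\<^sub>F L in at_top. (x2 / sqrt v + inverse L)\<^sup>2 / 2 + 2 * (inverse L)\<^sup>2 < R \<and> L > 0"
    using eventually_gt_at_top[of 0] by eventually_elim simp
  then obtain L where L: "(x2 / sqrt v + inverse L)\<^sup>2 / 2 + 2 * (inverse L)\<^sup>2 < R" "L > 0"
    using eventually_happens'[OF trivial_limit_at_top_linorder] by blast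
  define z where "z = x2 * L / sqrt v"
  define a where "a = (z + 1)\<^sup>2 / 2 + 2"
  have z: "z \<ge> 0" using x x1 x2 L v_pos by (simp add: z_def)
  have a: "a > 0" by (simp add: a_def add_nonneg_pos)
  have "a / L\<^sup>2 = (x2 / sqrt v + inverse L)\<^sup>2 / 2 + 2 * (inverse L)\<^sup>2"
  proof -
    define y where "y = x2 / sqrt v + inverse L"
    have zy: "z + 1 = L * y" using L by (simp add: y_def z_def field_simps)
    have "a = L\<^sup>2 * (y\<^sup>2 / 2 + 2 * (inverse L)\<^sup>2)"
      unfolding a_def zy using L(2) by (simp add: power_mult_distrib ring_distribs power_inverse)
    then show ?thesis using L by (simp add: y_def)
  qed
  then have aL: "a / L\<^sup>2 < R" using L by simp
  define k where "k n = nat \<lceil>G n / L\<^sup>2\<rceil>" for n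
  define m where "m n = n div k n" for n
  have kpos: "\<forall>\<^sub>F n in sequentially. k n \<ge> 1 \<and> G n / L\<^sup>2 \<le> real (k n) \<and> real (k n) \<le> G n / L\<^sup>2 + 1"
    using filterlim_at_top_dense[THEN iffD1, OF G, rule_format, of 0]
  proof eventually_elim
    case (elim n)
    then have "G n / L\<^sup>2 > 0" using L by simp
    then show ?case unfolding k_def by (auto simp: of_nat_nat; linarith)
  qed
  \<comment> \<open>The number of blocks is of order G(n) = o(n), while L stays fixed; so the
    central limit theorem applies in each block at one fixed level z.\<close>
  have m_top: "filterlim m at_top sequentially"
    unfolding filterlim_at_top
  proof
    fix N :: nat
    have "(\<lambda>n. real N * (G n / real n / L\<^sup>2 + 1 / real n)) \<longlonglongrightarrow> real N * (0 / L\<^sup>2 + 0)"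
      using L by (intro tendsto_intros Gn lim_1_over_n) auto
    then have "\<forall>\<^sub>F n in sequentially. real N * (G n / real n / L\<^sup>2 + 1 / real n) < 1"
      by (rule order_tendstoD) auto
    then show "\<forall>\<^sub>F n in sequentially. N \<le> m n"
      using kpos eventually_gt_at_top[of 0]
    proof eventually_elim
      case (elim n)
      have "real N * real (k n) \<le> real N * (G n / L\<^sup>2 + 1)"
        using elim by (intro mult_left_mono) auto
      also have "\<dots> = real n * (real N * (G n / real n / L\<^sup>2 + 1 / real n))"
        using elim by (simp add: field_simps)
      also have "\<dots> \<le> real n * 1" using elim by (intro mult_left_mono) auto
      finally have "N * k n \<le> n" by (simp flip: of_nat_mult)
      then show ?case using elim by (simp add: m_def less_eq_div_iff_mult_less_eq)
    qed
  qed
  have ev1: "\<forall>\<^sub>F n in sequentially. sum_tail (m n) (z * sqrt (real (m n) * v)) \<ge> exp (- a)"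
    using eventually_compose_filterlim[OF sum_tail_clt[OF z] m_top] by (simp add: a_def)
  have "filterlim (\<lambda>n. real (m n)) at_top sequentially"
    using m_top by (rule filterlim_compose[OF filterlim_real_sequentially])
  \<comment> \<open>Equivalent to x1^2 (m + 1) <= x2^2 m, which compensates for n being as large as
    k (m + 1).\<close>
  then have ev2: "\<forall>\<^sub>F n in sequentially. real (m n) \<ge> x1\<^sup>2 / (x2\<^sup>2 - x1\<^sup>2)"
    unfolding filterlim_at_top by blast
  \<comment> \<open>The first bound makes the Chebyshev error of the leftover terms at most 1/2. The
    second lets the gap R - a / L^2 absorb that factor 1/2 and the rounding of k.\<close>
  have ev3: "\<forall>\<^sub>F n in sequentially. G n \<ge> max (2 * v / (x1 - x)\<^sup>2) ((a + ln 2) / (R - a / L\<^sup>2))"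
    using G unfolding filterlim_at_top by blast
  show ?thesis
    using kpos ev1 ev2 ev3 filterlim_at_top_dense[THEN iffD1, OF G, rule_format, of 0]
      eventually_gt_at_top[of 0]
  proof eventually_elim
    case (elim n)
    define t where "t = sqrt (real n * G n)"
    have t: "t > 0" "t\<^sup>2 = real n * G n" using elim by (auto simp: t_def)
    define u where "u = x1 * t / real (k n)"
    define w where "w = (x1 - x) * t"
    have n: "n = k n * m n + n mod k n" by (simp add: m_def)
    have w: "w > 0" using x1 t by (simp add: w_def)
    have "u \<le> z * sqrt (real (m n) * v)"
    proof (rule power2_le_imp_le)
      have sq: "x2\<^sup>2 - x1\<^sup>2 > 0"
        using x x1 x2 power_strict_mono[of x1 x2 2] by auto
      have "x1\<^sup>2 * (real (m n) + 1) \<le> x2\<^sup>2 * real (m n)"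
        using elim(3) sq by (simp add: field_simps)
      then have "L\<^sup>2 * real (k n) * real (k n) * (x1\<^sup>2 * (real (m n) + 1)) \<le>
          L\<^sup>2 * real (k n) * real (k n) * (x2\<^sup>2 * real (m n))"
        by (intro mult_left_mono) auto
      moreover have "real n \<le> real (k n) * (real (m n) + 1)"
      proof -
        have "n mod k n \<le> k n" using elim by (simp add: less_imp_le)
        then have "n \<le> k n * m n + k n" using n by linarith
        then have "real n \<le> real (k n * m n + k n)" by (simp only: of_nat_le_iff)
        then show ?thesis by (simp add: ring_distribs)
      qed
      then have "x1\<^sup>2 * (real n * G n) \<le> x1\<^sup>2 * ((real (k n) * (real (m n) + 1)) * (L\<^sup>2 * real (k n)))"
        using elim L by (intro mult_left_mono mult_mono) (auto simp: field_simps)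
      ultimately have "x1\<^sup>2 * (real n * G n) \<le> L\<^sup>2 * real (k n) * real (k n) * (x2\<^sup>2 * real (m n))"
        by (simp add: mult_ac)
      then have "u\<^sup>2 \<le> x2\<^sup>2 * L\<^sup>2 * real (m n)"
        using elim by (simp add: u_def power_mult_distrib power_divide t divide_simps
            power2_eq_square[of "real (k n)"] mult_ac)
      also have "\<dots> = (z * sqrt (real (m n) * v))\<^sup>2"
        using v_pos by (simp add: z_def power_mult_distrib power_divide)
      finally show "u\<^sup>2 \<le> (z * sqrt (real (m n) * v))\<^sup>2" .
      show "0 \<le> z * sqrt (real (m n) * v)" using z v_pos by simp
    qed
    then have "exp (- a) \<le> sum_tail (m n) u"
      using elim(2) sum_tail_mono order_trans by blast
    then have "exp (- a) ^ k n \<le> sum_tail (m n) u ^ k n"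
      by (intro power_mono) auto
    also have "\<dots> \<le> sum_tail (k n * m n) (real (k n) * u)"
      using elim by (intro sum_tail_power) auto
    finally have 1: "exp (- (a * real (k n))) \<le> sum_tail (k n * m n) (real (k n) * u)"
      by (simp add: exp_of_nat_mult[symmetric] mult.commute)
    have 2: "1 / 2 \<le> sum_tail (n mod k n) (- w)"
    proof -
      have "real (n mod k n) * v / w\<^sup>2 \<le> real n * v / w\<^sup>2"
        using v_pos by (intro divide_right_mono mult_right_mono) auto
      also have "\<dots> \<le> 1 / 2"
        using elim x1 t w by (simp add: w_def power_mult_distrib divide_simps)
          (simp add: mult_ac)
      finally show ?thesis using sum_tail_neg[OF w, of "n mod k n"] by linarith
    qed
    have "exp (- (R * G n)) \<le> exp (- (a * (G n / L\<^sup>2 + 1)) - ln 2)"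
    proof -
      have "a + ln 2 \<le> (R - a / L\<^sup>2) * G n" using elim aL by (simp add: field_simps)
      then show ?thesis by (simp add: algebra_simps)
    qed
    also have "\<dots> \<le> exp (- (a * real (k n)) - ln 2)"
      using elim a by (simp add: mult_left_mono)
    also have "\<dots> = exp (- (a * real (k n))) * (1 / 2)"
      by (simp add: exp_diff)
    also have "\<dots> \<le> sum_tail (k n * m n) (real (k n) * u) * sum_tail (n mod k n) (- w)"
      using 1 2 by (intro mult_mono) (auto simp: sum_tail_def)
    also have "\<dots> \<le> sum_tail n (real (k n) * u + - w)"
      using sum_tail_add[of "k n * m n" _ "n mod k n"] n by metis
    also have "real (k n) * u + - w = x * t"
      using elim by (simp add: u_def w_def field_simps)
    finally show ?case by (simp add: t_def)
  qed
qed

end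

section \<open>Verification of the transfer hypotheses, and the theorem\<close>

lemma (in iid_centered) tail_transfer_sum_tail:
  assumes g: "regvar_class rho g" and x: "x > 0"
  shows "tail_transfer g rho tail (\<lambda>n. sum_tail n (x * sqrt (real n * g (ln (real n))))) (x\<^sup>2 / (2 * v))"
proof -
  interpret regvar_scale g rho by standard (rule g)
  show ?thesis
  proof
    fix A :: real assume A: "A > 0"
    have "\<forall>\<^sub>F n in sequentially. real n * tail (A * v / x * sqrt (real n / G n)) \<le> exp (- (\<kappa> * G n)) \<longrightarrow>
        sum_tail n (x * sqrt (real n * G n)) \<le>
        1 * (exp (- (\<kappa> * G n)) + exp (1 - (2 - exp A) * (x\<^sup>2 / (2 * v)) * G n))" if "\<kappa> > 0" for \<kappa>
      using G_gt[of "A / \<kappa>"] G_gt[of 0] eventually_ge_at_top[of 1]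
    proof eventually_elim
      case (elim n)
      then have "\<kappa> * G n \<ge> A" using that by (simp add: field_simps)
      with elim show ?case using sum_tail_upper[OF x _ _ A that, of "G n" n] by simp
    qed
    moreover have "A * v / x > 0" using A x v_pos by simp
    ultimately show "\<exists>B>0. \<exists>C>0. \<forall>\<kappa>>0. \<forall>\<^sub>F n in sequentially.
        real n * tail (C * sqrt (real n / G n)) \<le> exp (- (\<kappa> * G n)) \<longrightarrow>
        sum_tail n (x * sqrt (real n * G n)) \<le>
        B * (exp (- (\<kappa> * G n)) + exp (1 - (2 - exp A) * (x\<^sup>2 / (2 * v)) * G n))"
      using zero_less_one by blast
  next
    have "\<forall>\<^sub>F n in sequentially. sum_tail n (x * sqrt (real n * G n)) \<ge>
        1 / 2 * (real n * tail (2 * x * sqrt (real n * G n)))"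
      using G_gt[of "4 * v / x\<^sup>2"] G_gt[of 0] eventually_ge_at_top[of 1]
    proof eventually_elim
      case (elim n)
      then have "x\<^sup>2 * G n \<ge> 4 * v" using x by (simp add: field_simps)
      with elim show ?case using sum_tail_lower_jump[OF x, of "G n" n] by simp
    qed
    moreover have "2 * x > 0" "(1 / 2 :: real) > 0" using x by simp_all
    ultimately show "\<exists>C>0. \<exists>b>0. \<forall>\<^sub>F n in sequentially. sum_tail n (x * sqrt (real n * G n)) \<ge>
        b * (real n * tail (C * sqrt (real n * G n)))"
      by blast
  next
    fix R assume "R > x\<^sup>2 / (2 * v)"
    then show "\<forall>\<^sub>F n in sequentially. sum_tail n (x * sqrt (real n * G n)) \<ge> exp (- (R * G n))"
      by (rule sum_tail_lower_gauss[OF x G_at_top regvar_class_ln_over_n[OF g]])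
  qed (erule tail_mono, simp_all add: tail_def sum_tail_def)
qed

text \<open>The sign s is 1 or -1, so that upper and lower deviations are instances of the same
  one-sided result.\<close>

lemma (in prob_space) iid_centeredI:
  fixes X :: "nat \<Rightarrow> 'a \<Rightarrow> real"
  assumes rv [measurable]: "\<And>i. X i \<in> borel_measurable M"
    and indep: "indep_vars (\<lambda>_. borel) X UNIV"
    and ident: "\<And>i. distr M borel (X i) = distr M borel (X 0)"
    and sq: "integrable M (\<lambda>\<omega>. (X 0 \<omega>)\<^sup>2)"
    and v: "variance (X 0) > 0" and s: "s\<^sup>2 = 1"
  shows "iid_centered M (\<lambda>i \<omega>. s * (X i \<omega> - expectation (X 0))) (variance (X 0))"
proof
  let ?f = "\<lambda>x. s * (x - expectation (X 0))"
  have int: "integrable M (X 0)"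
    by (rule square_integrable_imp_integrable[OF rv sq])
  show "indep_vars (\<lambda>_. borel) (\<lambda>i \<omega>. ?f (X i \<omega>)) UNIV"
    by (rule indep_vars_compose2[OF indep]) simp
  have "distr M borel (\<lambda>\<omega>. ?f (X i \<omega>)) = distr (distr M borel (X i)) borel ?f" for i
    by (subst distr_distr) (simp_all add: comp_def)
  then show "distr M borel (\<lambda>\<omega>. ?f (X i \<omega>)) = distr M borel (\<lambda>\<omega>. ?f (X 0 \<omega>))" for i
    using ident[of i] by simp
  show "integrable M (\<lambda>\<omega>. (?f (X 0 \<omega>))\<^sup>2)"
    using int sq by (simp add: power_mult_distrib s power2_diff)
  show "expectation (\<lambda>\<omega>. ?f (X 0 \<omega>)) = 0"
    using int by (simp add: prob_space)
  show "expectation (\<lambda>\<omega>. (?f (X 0 \<omega>))\<^sup>2) = variance (X 0)"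
    by (simp add: power_mult_distrib s)
qed (use v in simp_all)

lemma (in prob_space) variance_pos_of_nondegenerate:
  fixes Y :: "'a \<Rightarrow> real"
  assumes [measurable]: "Y \<in> borel_measurable M" and sq: "integrable M (\<lambda>\<omega>. (Y \<omega>)\<^sup>2)"
    and nondeg: "\<And>c. prob {\<omega> \<in> space M. Y \<omega> = c} < 1"
  shows "variance Y > 0"
proof (rule ccontr)
  assume "\<not> ?thesis"
  then have "variance Y = 0" using variance_positive[of Y] by linarith
  moreover have "integrable M (\<lambda>\<omega>. (Y \<omega> - expectation Y)\<^sup>2)"
    using sq square_integrable_imp_integrable[OF _ sq] by (simp add: power2_diff)
  ultimately have "AE \<omega> in M. (Y \<omega> - expectation Y)\<^sup>2 = 0"
    by (subst (asm) integral_nonneg_eq_0_iff_AE) auto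
  then have "AE \<omega> in M. Y \<omega> = expectation Y" by eventually_elim simp
  then have "prob {\<omega> \<in> space M. Y \<omega> = expectation Y} = 1"
    by (subst prob_Collect_eq_1) auto
  with nondeg[of "expectation Y"] show False by simp
qed

theorem theorem2p1:
  fixes M :: "'a measure" and X :: "nat \<Rightarrow> 'a \<Rightarrow> real"
  assumes "prob_space M"
    and "\<And>i. X i \<in> borel_measurable M"
    and "prob_space.indep_vars M (\<lambda>_. borel) X UNIV"
    and "\<And>i. distr M borel (X i) = distr M borel (X 0)"
    and "integrable M (\<lambda>\<omega>. (X 0 \<omega>)\<^sup>2)"
    and "\<And>c. measure M {\<omega> \<in> space M. X 0 \<omega> = c} < 1"
    and "rho \<ge> 0" and "regvar_class rho g"
  defines "Pu \<equiv> (\<lambda>x n. measure M {\<omega> \<in> space M. (\<Sum>i\<in>{1..n}. X i \<omega>) - real n * integral\<^sup>L M (X 0) > x * sqrt (real n * g (ln (real n)))})"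
    and "Pl \<equiv> (\<lambda>x n. measure M {\<omega> \<in> space M. (\<Sum>i\<in>{1..n}. X i \<omega>) - real n * integral\<^sup>L M (X 0) < - (x * sqrt (real n * g (ln (real n))))})"
    and "Pa \<equiv> (\<lambda>x n. measure M {\<omega> \<in> space M. \<bar>(\<Sum>i\<in>{1..n}. X i \<omega>) - real n * integral\<^sup>L M (X 0)\<bar> > x * sqrt (real n * g (ln (real n)))})"
    and "T1 \<equiv> (\<lambda>t. measure M {\<omega> \<in> space M. X 0 \<omega> > t})"
    and "T2 \<equiv> (\<lambda>t. measure M {\<omega> \<in> space M. X 0 \<omega> < - t})"
    and "T \<equiv> (\<lambda>t. measure M {\<omega> \<in> space M. \<bar>X 0 \<omega>\<bar> > t})"
    and "r \<equiv> (\<lambda>x. ereal (x\<^sup>2 / (2 * integral\<^sup>L M (\<lambda>\<omega>. (X 0 \<omega> - integral\<^sup>L M (X 0))\<^sup>2))))"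
    and "c \<equiv> ereal (2 powr rho)"
  shows
   "(\<forall>x>0.
      limsup (ldev g (Pu x)) = - min (r x) (lam_over g T1 / c) \<and>
      liminf (ldev g (Pu x)) = - min (r x) (lam_under g T1 / c) \<and>
      limsup (ldev g (Pl x)) = - min (r x) (lam_over g T2 / c) \<and>
      liminf (ldev g (Pl x)) = - min (r x) (lam_under g T2 / c) \<and>
      limsup (ldev g (Pa x)) = - min (r x) (lam_over g T / c) \<and>
      liminf (ldev g (Pa x)) = - min (r x) (lam_under g T / c))
    \<and> (\<forall>lh::ereal. lh \<ge> 0 \<longrightarrow>
        ((\<forall>x>0. (ldev g (Pu x) \<longlongrightarrow> - min (r x) (lh / c)) sequentially)
           \<longleftrightarrow> lam_over g T1 = lh \<and> lam_under g T1 = lh) \<and>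
        ((\<forall>x>0. (ldev g (Pl x) \<longlongrightarrow> - min (r x) (lh / c)) sequentially)
           \<longleftrightarrow> lam_over g T2 = lh \<and> lam_under g T2 = lh) \<and>
        ((\<forall>x>0. (ldev g (Pa x) \<longlongrightarrow> - min (r x) (lh / c)) sequentially)
           \<longleftrightarrow> lam_over g T = lh \<and> lam_under g T = lh))
    \<and> ((\<forall>x>0. (ldev g (Pu x) \<longlongrightarrow> - r x) sequentially) \<longleftrightarrow> lam_over g T1 = \<infinity>)
    \<and> ((\<forall>x>0. (ldev g (Pl x) \<longlongrightarrow> - r x) sequentially) \<longleftrightarrow> lam_over g T2 = \<infinity>)
    \<and> ((\<forall>x>0. (ldev g (Pa x) \<longlongrightarrow> - r x) sequentially) \<longleftrightarrow> lam_over g T = \<infinity>)"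
proof -
  interpret prob_space M by fact
  note rv [measurable] = assms(2)
  define \<mu> where "\<mu> = expectation (X 0)"
  define v where "v = expectation (\<lambda>\<omega>. (X 0 \<omega> - \<mu>)\<^sup>2)"
  have v: "v > 0"
    using variance_pos_of_nondegenerate[of "X 0"] assms(5,6) by (simp add: v_def \<mu>_def)
  have r: "r = (\<lambda>x. ereal (x\<^sup>2 / (2 * v)))" by (simp add: r_def v_def \<mu>_def)
  note regvar = \<open>regvar_class rho g\<close>
  let ?t = "\<lambda>x n. x * sqrt (real n * g (ln (real n)))"
  interpret U: iid_centered M "\<lambda>i \<omega>. 1 * (X i \<omega> - \<mu>)" v
    using iid_centeredI[of X 1] assms(2-5) v unfolding \<mu>_def v_def by simp
  interpret L: iid_centered M "\<lambda>i \<omega>. - 1 * (X i \<omega> - \<mu>)" v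
    using iid_centeredI[of X "- 1"] assms(2-5) v unfolding \<mu>_def v_def by simp
  have PuU: "Pu x = (\<lambda>n. U.sum_tail n (?t x n))" for x
    unfolding Pu_def U.sum_tail_def \<mu>_def[symmetric] by (simp add: sum_subtractf)
  have PlL: "Pl x = (\<lambda>n. L.sum_tail n (?t x n))" for x
  proof
    fix n
    have "(\<Sum>i\<in>{1..n}. X i \<omega>) - real n * \<mu> < - ?t x n \<longleftrightarrow>
        ?t x n < (\<Sum>i\<in>{1..n}. - 1 * (X i \<omega> - \<mu>))" for \<omega>
      by (simp add: sum_subtractf) linarith
    then show "Pl x n = L.sum_tail n (?t x n)"
      unfolding Pl_def L.sum_tail_def \<mu>_def[symmetric] by simp
  qed
  \<comment> \<open>A nonnegative threshold makes the two one-sided events disjoint. The case n = 0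
    is included through the convention ln 0 = 0.\<close>
  have t_nonneg: "?t x n \<ge> 0" if "x > 0" for x n
  proof -
    have "ln (real n) \<ge> 0" by (cases n) auto
    then have "g (ln (real n)) \<ge> 0" using regvar by (simp add: regvar_class_def)
    then show ?thesis using that by simp
  qed
  have abs_gt_iff: "\<bar>y\<bar> > s \<longleftrightarrow> y > s \<or> y < - s" for y s :: real by linarith
  have Pa_sum: "Pa x = (\<lambda>n. Pu x n + Pl x n)" if x: "x > 0" for x
  proof
    fix n
    let ?S = "\<lambda>\<omega>. (\<Sum>i\<in>{1..n}. X i \<omega>) - real n * \<mu>"
    have "{\<omega> \<in> space M. \<bar>?S \<omega>\<bar> > ?t x n} =
        {\<omega> \<in> space M. ?S \<omega> > ?t x n} \<union> {\<omega> \<in> space M. ?S \<omega> < - ?t x n}"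
      unfolding abs_gt_iff by blast
    moreover have "prob ({\<omega> \<in> space M. ?S \<omega> > ?t x n} \<union> {\<omega> \<in> space M. ?S \<omega> < - ?t x n}) =
        prob {\<omega> \<in> space M. ?S \<omega> > ?t x n} + prob {\<omega> \<in> space M. ?S \<omega> < - ?t x n}"
      using t_nonneg[OF x, of n] by (intro finite_measure_Union) auto
    ultimately show "Pa x n = Pu x n + Pl x n"
      unfolding Pa_def Pu_def Pl_def \<mu>_def by simp
  qed
  \<comment> \<open>For negative t the two events overlap; \<open>T\<close> and
    \<open>T1 + T2\<close> are therefore matched only for large arguments, which is all that the
    comparison of tails asks for.\<close>
  have T_sum: "T t = T1 t + T2 t" if "t \<ge> 0" for t
  proof -
    have "{\<omega> \<in> space M. \<bar>X 0 \<omega>\<bar> > t} = {\<omega> \<in> space M. X 0 \<omega> > t} \<union> {\<omega> \<in> space M. X 0 \<omega> < - t}"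
      unfolding abs_gt_iff by blast
    moreover have "prob ({\<omega> \<in> space M. X 0 \<omega> > t} \<union> {\<omega> \<in> space M. X 0 \<omega> < - t}) =
        prob {\<omega> \<in> space M. X 0 \<omega> > t} + prob {\<omega> \<in> space M. X 0 \<omega> < - t}"
      using that by (intro finite_measure_Union) auto
    ultimately show ?thesis unfolding T_def T1_def T2_def by simp
  qed
  have T1_mono: "T1 t \<le> T1 s" and T2_mono: "T2 t \<le> T2 s" and T_mono: "T t \<le> T s" if "s \<le> t" for s t
    unfolding T1_def T2_def T_def by (intro finite_measure_mono; use that in force)+
  have Utail: "U.tail u = T1 (u + \<mu>)" for u
    unfolding U.tail_def T1_def by (simp add: less_diff_eq)
  have Ltail: "L.tail u = T2 (u - \<mu>)" for u
    unfolding L.tail_def T2_def by (intro arg_cong[where f = prob]) auto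
  \<comment> \<open>For u >= 2 |\<mu>| both u + \<mu> and u - \<mu> lie between u / 2 and 2
    u.\<close>
  have shift: "T1 (2 * u) \<le> U.tail u \<and> U.tail u \<le> T1 (u / 2)"
    "T2 (2 * u) \<le> L.tail u \<and> L.tail u \<le> T2 (u / 2)" if "u \<ge> 2 * \<bar>\<mu>\<bar>" for u
    unfolding Utail Ltail by (intro conjI T1_mono T2_mono; use that in linarith)+
  have u_large: "\<forall>\<^sub>F u in at_top. u \<ge> 2 * \<bar>\<mu>\<bar>" by (rule eventually_ge_at_top)
  have tU: "tail_transfer g rho T1 (Pu x) (x\<^sup>2 / (2 * v))" if "x > 0" for x
    unfolding PuU
  proof (rule tail_transfer_cong_scale[OF U.tail_transfer_sum_tail[OF regvar that]])
    show "\<forall>\<^sub>F u in at_top. T1 (2 * u) \<le> U.tail u \<and> U.tail u \<le> T1 (u / 2)"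
      using u_large by eventually_elim (rule shift)
  qed (erule T1_mono, simp add: T1_def)
  have tL: "tail_transfer g rho T2 (Pl x) (x\<^sup>2 / (2 * v))" if "x > 0" for x
    unfolding PlL
  proof (rule tail_transfer_cong_scale[OF L.tail_transfer_sum_tail[OF regvar that]])
    show "\<forall>\<^sub>F u in at_top. T2 (2 * u) \<le> L.tail u \<and> L.tail u \<le> T2 (u / 2)"
      using u_large by eventually_elim (rule shift)
  qed (erule T2_mono, simp add: T2_def)
  have tA: "tail_transfer g rho T (Pa x) (x\<^sup>2 / (2 * v))" if x: "x > 0" for x
  proof -
    have "Pu x n + Pl x n \<le> 1" for n
    proof -
      have "Pa x n \<le> 1" by (simp add: Pa_def)
      then show ?thesis unfolding Pa_sum[OF x] .
    qed
    then have "tail_transfer g rho (\<lambda>t. T1 t + T2 t) (Pa x) (x\<^sup>2 / (2 * v))"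
      unfolding Pa_sum[OF x] by (rule tail_transfer_add[OF tU[OF x] tL[OF x]])
    then show ?thesis
    proof (rule tail_transfer_cong_scale)
      show "\<forall>\<^sub>F u in at_top. T (2 * u) \<le> T1 u + T2 u \<and> T1 u + T2 u \<le> T (u / 2)"
        using eventually_ge_at_top[of 0]
      proof eventually_elim
        case (elim u)
        then show ?case using T_mono[of u "2 * u"] T_mono[of "u / 2" u] T_sum[of u] by simp
      qed
    qed (erule T_mono, simp add: T_def)
  qed
  note rates = tail_transfer.limsup_ldev tail_transfer.liminf_ldev
  show ?thesis
    unfolding r c_def
    by (intro conjI allI impI;
        (rule rates[OF tU] rates[OF tL] rates[OF tA], assumption |
         rule ldev_tendsto_iff[OF v tU] ldev_tendsto_iff[OF v tL] ldev_tendsto_iff[OF v tA]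
           ldev_tendsto_gauss_iff[OF v tU] ldev_tendsto_gauss_iff[OF v tL] ldev_tendsto_gauss_iff[OF v tA],
         assumption))
qed

end
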